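(* Let $\mathcal H_1=\mathcal H_1(\Omega_1)$ and $\mathcal H_2=\mathcal H_2(\Omega_2)$ be functional Hilbert spaces, let $X\in\mathcal B(\mathcal H_2,\mathcal H_1)$ and $Y\in\mathcal B(\mathcal H_1,\mathcal H_2)$, and let $T=\begin{bmatrix}0&X\\ Y&0\end{bmatrix}\in\mathcal B(\mathcal H_1\oplus\mathcal H_2)$. Let $f,g$ be nonnegative continuous functions on $[0,\infty)$ satisfying $f(t)g(t)=t$ for all $t\in[0,\infty)$. Then for every real $r\ge 1$, $$\mathbf{ber}^{r}(T)\le 2^{r-2}\Big(\mathbf{ber}\big(f^{2r}(|X|)+g^{2r}(|Y^*|)\big)+\mathbf{ber}\big(f^{2r}(|Y|)+g^{2r}(|X^*|)\big)\Big)-2^{r-2}\inf_{(\lambda_1,\lambda_2)\in\Omega_1\times\Omega_2}\eta(u_1,u_2),$$ where, for $(\lambda_1,\lambda_2)\in\Omega_1\times\Omega_2$, $(u_1,u_2)\in\mathcal H_1\oplus\mathcal H_2$ is the normalized kernel $\hat k_{(\lambda_1,\lambda_2)}$ (so $\|u_1\|^2+\|u_2\|^2=1$) and $$\eta(u_1,u_2)=\Big(\big\langle\big(f^{2r}(|X|)+g^{2r}(|Y^*|)\big)u_2,u_2\big\rangle^{1/2}-\big\langle\big(f^{2r}(|Y|)+g^{2r}(|X^*|)\big)u_1,u_1\big\rangle^{1/2}\Big)^2.$$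
   Context: A functional Hilbert space $\mathcal H=\mathcal H(\Omega)$ is a Hilbert space of complex valued functions on a nonempty set $\Omega$ such that for each $\lambda\in\Omega$ the evaluation $h\mapsto h(\lambda)$ is a continuous linear functional on $\mathcal H$; $k_\lambda\in\mathcal H$ denotes the unique element with $h(\lambda)=\langle h,k_\lambda\rangle$ for all $h\in\mathcal H$ (the reproducing kernel, tacitly nonzero for every $\lambda$), and $\hat k_\lambda=k_\lambda/\|k_\lambda\|$. For a bounded operator $A$ on $\mathcal H$, the Berezin symbol is $\widetilde A(\lambda)=\langle A\hat k_\lambda,\hat k_\lambda\rangle$ and the Berezin number is $\mathbf{ber}(A)=\sup\{|\widetilde A(\lambda)|:\lambda\in\Omega\}$; $\mathbf{ber}^{r}(A)=(\mathbf{ber}(A))^r$. On $\mathcal H_1(\Omega_1)\oplus\mathcal H_2(\Omega_2)$ the kernels are indexed by $(\lambda_1,\lambda_2)\in\Omega_1\times\Omega_2$: $k_{(\lambda_1,\lambda_2)}=(k_{\lambda_1},k_{\lambda_2})$, with normalization $\hat k_{(\lambda_1,\lambda_2)}=(k_{\lambda_1},k_{\lambda_2})/\sqrt{\|k_{\lambda_1}\|^2+\|k_{\lambda_2}\|^2}$, and for a bounded operator $T$ on the direct sum $\mathbf{ber}(T)=\sup_{(\lambda_1,\lambda_2)}|\langle T\hat k_{(\lambda_1,\lambda_2)},\hat k_{(\lambda_1,\lambda_2)}\rangle|$. $\mathcal B(\mathcal H,\mathcal K)$ is the space of bounded linear operators from $\mathcal H$ to $\mathcal K$, $|A|=(A^*A)^{1/2}$,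 and functions of positive operators are taken by continuous functional calculus, with $f^{s}(|A|)$ meaning $(f(|A|))^{s}$. *)

theory Defs
  imports "HOL-Analysis.Analysis" "HOL-Computational_Algebra.Polynomial"
begin

section \<open>Complex Hilbert spaces\<close>

text \<open>The real inner product and the norm are the ones underlying the complex inner product,
  which is linear in its first argument. Completeness is part of class \<open>banach\<close>.\<close>

class complex_hilbert = real_inner + banach +
  fixes scaleC :: "complex \<Rightarrow> 'a \<Rightarrow> 'a"  (infixr \<open>*\<^sub>C\<close> 75)
    and cinner :: "'a \<Rightarrow> 'a \<Rightarrow> complex"
  assumes scaleC_add_right: "c *\<^sub>C (x + y) = c *\<^sub>C x + c *\<^sub>C y"
    and scaleC_add_left: "(c + d) *\<^sub>C x = c *\<^sub>C x + d *\<^sub>C x"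
    and scaleC_scaleC: "c *\<^sub>C d *\<^sub>C x = (c * d) *\<^sub>C x"
    and scaleC_of_real: "complex_of_real t *\<^sub>C x = t *\<^sub>R x"
    and cinner_commute: "cinner x y = cnj (cinner y x)"
    and cinner_add_left: "cinner (x + y) z = cinner x z + cinner y z"
    and cinner_scaleC_left: "cinner (c *\<^sub>C x) y = c * cinner x y"
    and inner_eq_Re_cinner: "inner x y = Re (cinner x y)"

text \<open>The product type is the Hilbert space direct sum: its norm is the square root of
  the sum of the squared norms.\<close>

instantiation prod :: (complex_hilbert, complex_hilbert) complex_hilbert
begin

definition scaleC_prod_def: "c *\<^sub>C x = (c *\<^sub>C fst x, c *\<^sub>C snd x)"

definition cinner_prod_def: "cinner x y = cinner (fst x) (fst y) + cinner (snd x) (snd y)"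

instance
proof
  fix c d :: complex and t :: real and x y z :: "'a \<times> 'b"
  show "c *\<^sub>C (x + y) = c *\<^sub>C x + c *\<^sub>C y"
    by (simp add: scaleC_prod_def scaleC_add_right)
  show "(c + d) *\<^sub>C x = c *\<^sub>C x + d *\<^sub>C x"
    by (simp add: scaleC_prod_def scaleC_add_left)
  show "c *\<^sub>C d *\<^sub>C x = (c * d) *\<^sub>C x"
    by (simp add: scaleC_prod_def scaleC_scaleC)
  show "complex_of_real t *\<^sub>C x = t *\<^sub>R x"
    by (simp add: scaleC_prod_def scaleC_of_real prod_eq_iff)
  show "cinner x y = cnj (cinner y x)"
    using cinner_commute[of "fst x" "fst y"] cinner_commute[of "snd x" "snd y"]
    by (simp add: cinner_prod_def)
  show "cinner (x + y) z = cinner x z + cinner y z"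
    by (simp add: cinner_prod_def cinner_add_left)
  show "cinner (c *\<^sub>C x) y = c * cinner x y"
    by (simp add: cinner_prod_def scaleC_prod_def cinner_scaleC_left distrib_left)
  show "inner x y = Re (cinner x y)"
    by (simp add: cinner_prod_def inner_prod_def inner_eq_Re_cinner)
qed

end


section \<open>Bounded operators\<close>

text \<open>\<open>\<B>(H, K)\<close> is the set of the complex-linear members of the type of bounded real-linear
  maps; operator norm, sum and composition are those of the type.\<close>

definition cblinfun :: "('a::complex_hilbert \<Rightarrow>\<^sub>L 'b::complex_hilbert) set" where
  "cblinfun = {A. \<forall>c x. blinfun_apply A (c *\<^sub>C x) = c *\<^sub>C blinfun_apply A x}"

definition adj :: "'a::complex_hilbert \<Rightarrow>\<^sub>L 'b::complex_hilbert \<Rightarrow> 'b \<Rightarrow>\<^sub>L 'a" where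
  "adj A = (THE B. \<forall>x y. cinner (A x) y = cinner x (blinfun_apply B y))"

definition block_op ::
  "'a::complex_hilbert \<Rightarrow>\<^sub>L 'a \<Rightarrow> 'b::complex_hilbert \<Rightarrow>\<^sub>L 'a \<Rightarrow> 'a \<Rightarrow>\<^sub>L 'b \<Rightarrow> 'b \<Rightarrow>\<^sub>L 'b
    \<Rightarrow> ('a \<times> 'b) \<Rightarrow>\<^sub>L ('a \<times> 'b)" where
  "block_op A B C D = Blinfun (\<lambda>x. (A (fst x) + B (snd x), C (fst x) + D (snd x)))"

lemma block_op_apply:
  "blinfun_apply (block_op A B C D) (x, y) =
    (blinfun_apply A x + blinfun_apply B y, blinfun_apply C x + blinfun_apply D y)"
proof -
  have "bounded_linear (\<lambda>x. (blinfun_apply A (fst x) + blinfun_apply B (snd x),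
      blinfun_apply C (fst x) + blinfun_apply D (snd x)))"
    by (intro bounded_linear_Pair bounded_linear_add
        bounded_linear_compose[OF blinfun.bounded_linear_right bounded_linear_fst]
        bounded_linear_compose[OF blinfun.bounded_linear_right bounded_linear_snd])
  then show ?thesis
    by (simp add: block_op_def bounded_linear_Blinfun_apply)
qed

definition op_spectrum :: "'a::complex_hilbert \<Rightarrow>\<^sub>L 'a \<Rightarrow> complex set" where
  "op_spectrum A =
    {z. \<not> (\<exists>B\<in>cblinfun. \<forall>x. B (A x - z *\<^sub>C x) = x \<and> A (B x) - z *\<^sub>C B x = x)}"

definition op_poly :: "real poly \<Rightarrow> 'a::complex_hilbert \<Rightarrow>\<^sub>L 'a \<Rightarrow> 'a \<Rightarrow>\<^sub>L 'a" where
  "op_poly p A = (\<Sum>i\<le>degree p. coeff p i *\<^sub>R (((o\<^sub>L) A ^^ i) id_blinfun))"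

text \<open>Continuous functional calculus, meaningful for a self-adjoint \<open>A\<close> (whose spectrum is real)
  and a real function \<open>f\<close> continuous on the spectrum: \<open>f(A)\<close> is the common norm limit of
  \<open>p\<^sub>n(A)\<close>, for all real polynomials \<open>p\<^sub>n\<close> converging to \<open>f\<close> uniformly on the spectrum.\<close>

definition cfc :: "(real \<Rightarrow> real) \<Rightarrow> 'a::complex_hilbert \<Rightarrow>\<^sub>L 'a \<Rightarrow> 'a \<Rightarrow>\<^sub>L 'a" where
  "cfc f A = (THE B. \<forall>p. uniform_limit {t. complex_of_real t \<in> op_spectrum A}
      (\<lambda>n t. poly (p n) t) f sequentially \<longrightarrow> (\<lambda>n. op_poly (p n) A) \<longlonglongrightarrow> B)"

definition abs_op :: "'a::complex_hilbert \<Rightarrow>\<^sub>L 'b::complex_hilbert \<Rightarrow> 'a \<Rightarrow>\<^sub>L 'a" where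
  "abs_op A = cfc sqrt (adj A o\<^sub>L A)"

text \<open>Real powers of a positive operator; only used for exponents \<open>s > 0\<close>, for which
  \<open>t powr s\<close> is continuous on \<open>t \<ge> 0\<close> with value \<open>0\<close> at \<open>0\<close>.\<close>

definition op_powr :: "'a::complex_hilbert \<Rightarrow>\<^sub>L 'a \<Rightarrow> real \<Rightarrow> 'a \<Rightarrow>\<^sub>L 'a" where
  "op_powr A s = cfc (\<lambda>t. t powr s) A"


section \<open>Functional Hilbert spaces and the Berezin number\<close>

text \<open>The elements of the Hilbert space are identified with functions on \<open>\<Omega>\<close> through
  \<open>ev\<close>: \<open>ev h l\<close> is the value \<open>h(l)\<close>. The values outside \<open>\<Omega>\<close> are irrelevant.\<close>

locale functional_hilbert_space =
  fixes \<Omega> :: "'w set" and ev :: "'h::complex_hilbert \<Rightarrow> 'w \<Rightarrow> complex"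
  assumes nonempty: "\<Omega> \<noteq> {}"
    and ev_inject: "(\<And>l. l \<in> \<Omega> \<Longrightarrow> ev h l = ev h' l) \<Longrightarrow> h = h'"
    and ev_add: "l \<in> \<Omega> \<Longrightarrow> ev (h + h') l = ev h l + ev h' l"
    and ev_scaleC: "l \<in> \<Omega> \<Longrightarrow> ev (c *\<^sub>C h) l = c * ev h l"
    and ev_continuous: "l \<in> \<Omega> \<Longrightarrow> continuous_on UNIV (\<lambda>h. ev h l)"

definition rep_kernel :: "('h::complex_hilbert \<Rightarrow> 'w \<Rightarrow> complex) \<Rightarrow> 'w \<Rightarrow> 'h" where
  "rep_kernel ev l = (THE k. \<forall>h. ev h l = cinner h k)"

definition normalized :: "('w \<Rightarrow> 'h::complex_hilbert) \<Rightarrow> 'w \<Rightarrow> 'h" where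
  "normalized k l = k l /\<^sub>R norm (k l)"

text \<open>On a direct sum the kernels are the pairs \<open>(k\<^sub>1 l\<^sub>1, k\<^sub>2 l\<^sub>2)\<close>. They do not come from a
  realisation of the sum as a space of functions, so the Berezin number takes the family of
  kernels as an argument.\<close>

definition sum_kernel ::
  "('v \<Rightarrow> 'a::complex_hilbert) \<Rightarrow> ('w \<Rightarrow> 'b::complex_hilbert) \<Rightarrow> 'v \<times> 'w \<Rightarrow> 'a \<times> 'b" where
  "sum_kernel k1 k2 l = (k1 (fst l), k2 (snd l))"

definition berezin_symbol ::
  "('w \<Rightarrow> 'h::complex_hilbert) \<Rightarrow> 'h \<Rightarrow>\<^sub>L 'h \<Rightarrow> 'w \<Rightarrow> complex" where
  "berezin_symbol k A l = cinner (A (normalized k l)) (normalized k l)"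

definition ber :: "'w set \<Rightarrow> ('w \<Rightarrow> 'h::complex_hilbert) \<Rightarrow> 'h \<Rightarrow>\<^sub>L 'h \<Rightarrow> real" where
  "ber \<Omega> k A = (SUP l\<in>\<Omega>. cmod (berezin_symbol k A l))"

text \<open>For positive \<open>P\<close>, \<open>Q\<close> the complex numbers \<open>\<langle>Q u\<^sub>2, u\<^sub>2\<rangle>\<close> and \<open>\<langle>P u\<^sub>1, u\<^sub>1\<rangle>\<close> are real and
  nonnegative, so taking real parts only changes the type.\<close>

definition eta ::
  "'a::complex_hilbert \<Rightarrow>\<^sub>L 'a \<Rightarrow> 'b::complex_hilbert \<Rightarrow>\<^sub>L 'b \<Rightarrow> 'a \<times> 'b \<Rightarrow> real" where
  "eta P Q u = (sqrt (Re (cinner (Q (snd u)) (snd u))) - sqrt (Re (cinner (P (fst u)) (fst u))))\<^sup>2"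

end

theory Submission
  imports Defs "HOL-Computational_Algebra.Fundamental_Theorem_Algebra"
begin

text \<open>Everything reduces to the single operator \<open>N = X\<^sup>*X\<close> (and \<open>XX\<^sup>*\<close>): \<open>f(|X|)\<^sup>2\<^sup>r\<close> is \<open>\<phi>(N)\<close> with
  \<open>\<phi>(t) = f(\<surd>t)\<^sup>2\<^sup>r\<close>. For a unit kernel \<open>(u\<^sub>1, u\<^sub>2)\<close> the mixed Schwarz inequality
  \<open>|\<langle>X u, v\<rangle>| \<le> \<parallel>f(|X|) u\<parallel> \<parallel>g(|X\<^sup>*|) v\<parallel>\<close>, convexity of the power and McCarthy's inequality bound
  \<open>|\<langle>T u, u\<rangle>|\<^sup>r\<close> by \<open>2\<^sup>r\<^sup>-\<^sup>1 \<langle>Q u\<^sub>2, u\<^sub>2\<rangle>\<^sup>1\<^sup>/\<^sup>2 \<langle>P u\<^sub>1, u\<^sub>1\<rangle>\<^sup>1\<^sup>/\<^sup>2\<close>, and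
  \<open>2 \<surd>S \<surd>T = S + T - (\<surd>S - \<surd>T)\<^sup>2\<close> produces \<open>\<eta>\<close>. The functional calculus rests on
  \<open>\<parallel>p(A)\<parallel> \<le> sup |p|\<close> over the real spectrum of a self-adjoint \<open>A\<close>, proved by factoring \<open>p \<mp> \<parallel>p(A)\<parallel>\<close> into
  real linear and quadratic factors, all bounded below if no root lies in the spectrum.\<close>

section \<open>The complex inner product and adjoints\<close>

lemma cinner_scaleC_right: "cinner x (c *\<^sub>C y) = cnj c * cinner x y"
  by (metis cinner_commute cinner_scaleC_left complex_cnj_mult)

lemma inner_scaleC_left: "inner (c *\<^sub>C x) y = inner x (cnj c *\<^sub>C y)"
  for x y :: "'a::complex_hilbert"
  by (simp add: inner_eq_Re_cinner cinner_scaleC_left cinner_scaleC_right)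

text \<open>Multiplying the second argument by \<open>\<i>\<close> moves the imaginary part into the
  real part, so identities for \<open>cinner\<close> can be checked on \<open>inner\<close>
  alone.\<close>

lemma cinner_eq_Complex: "cinner x y = Complex (inner x y) (inner x (\<i> *\<^sub>C y))"
  for x y :: "'a::complex_hilbert"
  by (simp add: inner_eq_Re_cinner cinner_scaleC_right complex_eq_iff)

lemma norm_scaleC: "norm (c *\<^sub>C x) = cmod c * norm x"
  for x :: "'a::complex_hilbert"
proof -
  have "inner (c *\<^sub>C x) (c *\<^sub>C x) = inner x (complex_of_real ((cmod c)\<^sup>2) *\<^sub>C x)"
    by (simp only: inner_scaleC_left scaleC_scaleC complex_norm_square mult.commute)
  then have "(norm (c *\<^sub>C x))\<^sup>2 = (cmod c * norm x)\<^sup>2"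
    by (simp only: scaleC_of_real power2_norm_eq_inner power_mult_distrib inner_scaleR_right)
  then show ?thesis
    by (simp add: power2_eq_iff_nonneg)
qed

lemma scaleC_scaleR: "c *\<^sub>C t *\<^sub>R x = t *\<^sub>R c *\<^sub>C x"
  for x :: "'a::complex_hilbert"
  by (metis scaleC_of_real scaleC_scaleC mult.commute)

lemma bounded_linear_scaleC: "bounded_linear (\<lambda>x::'a::complex_hilbert. c *\<^sub>C x)"
  by (rule bounded_linear_intro[where K = "cmod c"])
     (simp_all add: scaleC_add_right scaleC_scaleR norm_scaleC mult.commute)

text \<open>Cancelling the phase of \<open>cinner x y\<close> by a unimodular factor reduces bounds
  on moduli to bounds on the real inner product.\<close>

lemma cmod_cinner_rotate:
  fixes x y :: "'a::complex_hilbert"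
  obtains c where "cmod c = 1" "cmod (cinner x y) = inner (c *\<^sub>C x) y"
proof
  let ?z = "cinner x y"
  \<comment> \<open>The value 1 is needed when \<open>?z = 0\<close>, because
    \<open>sgn 0 = 0\<close> is not unimodular.\<close>
  let ?c = "if ?z = 0 then 1 else cnj (sgn ?z)"
  show "cmod ?c = 1"
    by (simp add: norm_sgn)
  have "cnj (sgn z) * z = complex_of_real (cmod z)" for z
    by (cases "z = 0") (simp_all add: sgn_eq complex_norm_square[symmetric] mult.commute power2_eq_square)
  then have "?c * ?z = complex_of_real (cmod ?z)"
    by simp
  then have "Re (cinner (?c *\<^sub>C x) y) = cmod ?z"
    by (metis Re_complex_of_real cinner_scaleC_left)
  then show "cmod ?z = inner (?c *\<^sub>C x) y"
    by (simp only: inner_eq_Re_cinner)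
qed

lemma cblinfunD: "A \<in> cblinfun \<Longrightarrow> blinfun_apply A (c *\<^sub>C x) = c *\<^sub>C blinfun_apply A x"
  by (simp add: cblinfun_def)

text \<open>The representing vector minimises \<open>\<parallel>x\<parallel>\<^sup>2 - 2 \<phi>(x)\<close>; minimising sequences are Cauchy
  by the parallelogram law.\<close>

lemma riesz_representation:
  fixes \<phi> :: "'a::{real_inner,banach} \<Rightarrow> real"
  assumes "bounded_linear \<phi>"
  obtains k where "\<And>x. \<phi> x = inner k x"
proof -
  interpret bounded_linear \<phi> by fact
  obtain K where K: "\<And>x. \<bar>\<phi> x\<bar> \<le> norm x * K"
    using bounded by auto
  define J where "J x = (norm x)\<^sup>2 - 2 * \<phi> x" for x
  define d where "d = Inf (range J)"
  have "- K\<^sup>2 \<le> J x" for x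
  proof -
    have "0 \<le> (norm x - K)\<^sup>2" by simp
    then show ?thesis
      using K[of x] unfolding J_def by (simp add: power2_eq_square algebra_simps abs_le_iff)
  qed
  then have bdd: "bdd_below (range J)" by (intro bdd_belowI2)
  have d_le: "d \<le> J x" for x
    unfolding d_def by (rule cInf_lower[OF _ bdd]) simp
  have "\<exists>x. J x < d + 1 / real (Suc n)" for n
  proof -
    have "\<exists>y\<in>range J. y < d + 1 / real (Suc n)"
      by (rule cInf_lessD) (simp_all add: d_def)
    then show ?thesis by auto
  qed
  then obtain X where X: "\<And>n. J (X n) < d + 1 / real (Suc n)" by metis
  \<comment> \<open>In the parallelogram law the linear parts of \<open>J\<close> cancel, and
    \<open>J\<close> at the midpoint is at least \<open>d\<close>.\<close>
  have par: "(norm (x - y))\<^sup>2 \<le> 2 * (J x - d) + 2 * (J y - d)" for x y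
  proof -
    have "(norm (x - y))\<^sup>2 + 4 * J ((1/2) *\<^sub>R (x + y)) = 2 * J x + 2 * J y"
      unfolding J_def power2_norm_eq_inner
      by (simp add: inner_simps scale add inner_commute[of y x] field_simps)
    then show ?thesis using d_le[of "(1/2) *\<^sub>R (x + y)"] by simp
  qed
  have "Cauchy X"
  proof (rule metric_CauchyI)
    fix e :: real assume "0 < e"
    \<comment> \<open>\<open>par\<close> bounds the squared distance by twice the two excesses over
      \<open>d\<close>, each below \<open>1 / N\<close>; hence the 4.\<close>
    then obtain N where N: "4 / e\<^sup>2 < real N"
      using reals_Archimedean2 by blast
    have "dist (X m) (X n) < e" if "N \<le> m" "N \<le> n" for m n
    proof -
      have "0 < real N" using N \<open>0 < e\<close> by (meson divide_pos_pos less_trans zero_less_numeral zero_less_power)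
      then have "1 / real (Suc m) \<le> 1 / real N" "1 / real (Suc n) \<le> 1 / real N"
        using that by (auto intro!: divide_left_mono)
      then have "(norm (X m - X n))\<^sup>2 < 4 * (1 / real N)"
        using par[of "X m" "X n"] X[of m] X[of n] by argo
      also have "4 * (1 / real N) < e\<^sup>2"
        using N \<open>0 < e\<close> \<open>0 < real N\<close> by (simp add: field_simps)
      finally show ?thesis
        using \<open>0 < e\<close> by (simp add: dist_norm power_less_imp_less_base)
    qed
    then show "\<exists>M. \<forall>m\<ge>M. \<forall>n\<ge>M. dist (X m) (X n) < e" by blast
  qed
  then obtain k where k: "X \<longlonglongrightarrow> k"
    using Cauchy_convergent_iff convergent_def by blast
  have "(\<lambda>n. J (X n)) \<longlonglongrightarrow> J k"
    unfolding J_def by (intro tendsto_intros tendsto k)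
  moreover have "(\<lambda>n. d + 1 / real (Suc n)) \<longlonglongrightarrow> d + 0"
    by (intro tendsto_intros LIMSEQ_Suc[OF lim_1_over_n])
  ultimately have "J k \<le> d + 0"
    by (rule LIMSEQ_le) (use X in \<open>auto intro: less_imp_le\<close>)
  then have min: "J k \<le> J x" for x using d_le[of x] by simp
  show thesis
  proof
    fix x
    define b where "b = inner k x - \<phi> x"
    define a where "a = (norm x)\<^sup>2"
    \<comment> \<open>First variation at the minimiser: a parabola through 0 that stays nonnegative
      has no linear term. The test values below are \<open>- b\<close> if \<open>a = 0\<close>, and
      otherwise the vertex \<open>- b / a\<close>.\<close>
    have quad: "0 \<le> t\<^sup>2 * a + 2 * t * b" for t
    proof -
      have "J (k + t *\<^sub>R x) = J k + (t\<^sup>2 * a + 2 * t * b)"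
        unfolding J_def a_def b_def power2_norm_eq_inner
        by (simp add: inner_simps scale add inner_commute[of x k] power2_eq_square algebra_simps)
      then show ?thesis using min[of "k + t *\<^sub>R x"] by simp
    qed
    have "b = 0"
    proof (cases "a = 0")
      case True
      then show ?thesis using quad[of "-b"] by (simp add: power2_eq_square[symmetric])
    next
      case False
      then have "0 < a" by (simp add: a_def)
      have "0 \<le> - (b\<^sup>2 / a)"
        using quad[of "- b / a"] \<open>0 < a\<close> by (simp add: power2_eq_square field_simps)
      then show ?thesis using \<open>0 < a\<close> by (simp add: divide_le_0_iff)
    qed
    then show "\<phi> x = inner k x" by (simp add: b_def)
  qed
qed

text \<open>Adjointness as a relation for the real inner product: it composes, passes to limits and
  expresses self-adjointness as \<open>is_adj A A\<close>, without unfolding the description in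
  \<open>adj\<close>. Complex linearity enters only when the two are identified.\<close>

definition is_adj :: "('a::complex_hilbert \<Rightarrow>\<^sub>L 'b::complex_hilbert) \<Rightarrow> ('b \<Rightarrow>\<^sub>L 'a) \<Rightarrow> bool" where
  "is_adj C D \<longleftrightarrow> (\<forall>x y. inner (blinfun_apply C x) y = inner x (blinfun_apply D y))"

lemma is_adjD: "is_adj C D \<Longrightarrow> inner (blinfun_apply C x) y = inner x (blinfun_apply D y)"
  by (simp add: is_adj_def)

lemma is_adj_sym:
  assumes "is_adj C D"
  shows "is_adj D C"
  unfolding is_adj_def
proof (intro allI)
  show "inner (blinfun_apply D y) x = inner y (blinfun_apply C x)" for x y
    using is_adjD[OF assms, of x y] by (simp only: inner_commute[of y] inner_commute[of _ x])
qed

text \<open>Riesz gives \<open>D y\<close> for each \<open>y\<close>; linearity follows because a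
  vector is determined by its inner products, and boundedness from \<open>norm (D y)\<close> squared
  being \<open>inner (C (D y)) y\<close>.\<close>

lemma is_adj_exists:
  fixes C :: "'a::complex_hilbert \<Rightarrow>\<^sub>L 'b::complex_hilbert"
  obtains D where "is_adj C D"
proof -
  have "\<exists>k. \<forall>x. inner (blinfun_apply C x) y = inner k x" for y
  proof -
    have "bounded_linear (\<lambda>x. inner (blinfun_apply C x) y)"
      by (intro bounded_linear_compose[OF bounded_linear_inner_left] blinfun.bounded_linear_right)
    then show ?thesis by (rule riesz_representation) blast
  qed
  then obtain D where D: "\<And>x y. inner (blinfun_apply C x) y = inner (D y) x" by metis
  have "bounded_linear D"
  proof (rule bounded_linear_intro[where K = "norm C"])
    show "D (x + y) = D x + D y" for x y
      by (rule vector_eq_rdot[THEN iffD1]) (simp add: inner_simps D[symmetric])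
    show "D (t *\<^sub>R x) = t *\<^sub>R D x" for t x
      by (rule vector_eq_rdot[THEN iffD1]) (simp add: inner_simps D[symmetric])
    show "norm (D y) \<le> norm y * norm C" for y
    proof -
      have "norm (D y) * norm (D y) = inner (C (D y)) y"
        by (simp add: D norm_eq_square dot_square_norm power2_eq_square)
      also have "\<dots> \<le> norm (C (D y)) * norm y"
        by (rule norm_cauchy_schwarz)
      also have "\<dots> \<le> (norm C * norm (D y)) * norm y"
        by (intro mult_right_mono norm_blinfun) simp
      finally have "norm (D y) * norm (D y) \<le> norm (D y) * (norm y * norm C)"
        by (simp add: mult_ac)
      then show ?thesis
        by (cases "D y = 0") simp_all
    qed
  qed
  then have "is_adj (Blinfun D) C"
    by (simp add: is_adj_def bounded_linear_Blinfun_apply flip: D) (simp add: inner_commute)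
  then have "is_adj C (Blinfun D)"
    by (rule is_adj_sym)
  then show thesis ..
qed

lemma is_adj_unique: "is_adj C D \<Longrightarrow> is_adj C D' \<Longrightarrow> D = D'"
  by (rule blinfun_eqI, rule vector_eq_ldot[THEN iffD1]) (simp flip: is_adjD)

lemma is_adj_cblinfun:
  assumes "is_adj C D" "C \<in> cblinfun"
  shows "D \<in> cblinfun"
proof -
  have "inner x (blinfun_apply D (c *\<^sub>C y)) = inner x (c *\<^sub>C blinfun_apply D y)" for x c y
    proof -
    have "inner x (blinfun_apply D (c *\<^sub>C y)) = inner (blinfun_apply C (cnj c *\<^sub>C x)) y"
      by (simp add: is_adjD[OF assms(1), symmetric] cblinfunD[OF assms(2)] inner_scaleC_left)
    then show ?thesis
      by (simp add: is_adjD[OF assms(1)] inner_scaleC_left)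
  qed
  then show ?thesis
    unfolding cblinfun_def using vector_eq_ldot by blast
qed

lemma is_adj_cinner:
  assumes "is_adj C D" "C \<in> cblinfun"
  shows "cinner (blinfun_apply C x) y = cinner x (blinfun_apply D y)"
  by (simp add: cinner_eq_Complex is_adjD[OF assms(1)] cblinfunD[OF is_adj_cblinfun[OF assms]])

lemma adj_eqI:
  assumes "is_adj C D" "C \<in> cblinfun"
  shows "adj C = D"
  unfolding adj_def
proof (rule the_equality)
  show "\<forall>x y. cinner (blinfun_apply C x) y = cinner x (blinfun_apply D y)"
    using is_adj_cinner[OF assms] by blast
  show "B = D" if "\<forall>x y. cinner (blinfun_apply C x) y = cinner x (blinfun_apply B y)" for B
    by (rule is_adj_unique[OF _ assms(1)]) (simp add: is_adj_def inner_eq_Re_cinner that)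
qed

lemma is_adj_adj:
  assumes "C \<in> cblinfun"
  shows "is_adj C (adj C)"
proof -
  obtain D where "is_adj C D" by (rule is_adj_exists)
  then show ?thesis using adj_eqI[OF _ assms] by simp
qed

lemma adj_cblinfun: "C \<in> cblinfun \<Longrightarrow> adj C \<in> cblinfun"
  by (rule is_adj_cblinfun[OF is_adj_adj])

lemma adj_adj: "C \<in> cblinfun \<Longrightarrow> adj (adj C) = C"
  by (rule adj_eqI[OF is_adj_sym[OF is_adj_adj] adj_cblinfun])

section \<open>Closure properties of complex-linear operators and adjoint pairs\<close>

lemma id_blinfun_cblinfun: "id_blinfun \<in> cblinfun"
  by (simp add: cblinfun_def)

lemma cblinfun_add: "A \<in> cblinfun \<Longrightarrow> B \<in> cblinfun \<Longrightarrow> A + B \<in> cblinfun"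
  by (simp add: cblinfun_def blinfun.add_left scaleC_add_right)

lemma cblinfun_scaleR: "A \<in> cblinfun \<Longrightarrow> t *\<^sub>R A \<in> cblinfun"
  by (simp add: cblinfun_def blinfun.scaleR_left scaleC_scaleR)

lemma cblinfun_compose: "A \<in> cblinfun \<Longrightarrow> B \<in> cblinfun \<Longrightarrow> A o\<^sub>L B \<in> cblinfun"
  by (simp add: cblinfun_def)

lemma cblinfun_LIMSEQ:
  assumes "\<And>n. X n \<in> cblinfun" "X \<longlonglongrightarrow> L"
  shows "L \<in> cblinfun"
proof -
  have "L (c *\<^sub>C x) = c *\<^sub>C L x" for c x
  proof (rule LIMSEQ_unique)
    show "(\<lambda>n. X n (c *\<^sub>C x)) \<longlonglongrightarrow> L (c *\<^sub>C x)"
      by (intro blinfun.tendsto assms tendsto_const)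
    have "(\<lambda>n. c *\<^sub>C X n x) \<longlonglongrightarrow> c *\<^sub>C L x"
      by (intro bounded_linear.tendsto[OF bounded_linear_scaleC] blinfun.tendsto assms tendsto_const)
    then show "(\<lambda>n. X n (c *\<^sub>C x)) \<longlonglongrightarrow> c *\<^sub>C L x"
      by (simp add: cblinfunD[OF assms(1)])
  qed
  then show ?thesis by (simp add: cblinfun_def)
qed

lemma is_adj_LIMSEQ:
  assumes "\<And>n. is_adj (X n) (Y n)" "X \<longlonglongrightarrow> K" "Y \<longlonglongrightarrow> L"
  shows "is_adj K L"
  unfolding is_adj_def
proof (intro allI, rule LIMSEQ_unique)
  fix x y
  show "(\<lambda>n. inner (X n x) y) \<longlonglongrightarrow> inner (K x) y"
    by (intro tendsto_inner blinfun.tendsto assms tendsto_const)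
  have "(\<lambda>n. inner x (Y n y)) \<longlonglongrightarrow> inner x (L y)"
    by (intro tendsto_inner blinfun.tendsto assms tendsto_const)
  then show "(\<lambda>n. inner (X n x) y) \<longlonglongrightarrow> inner x (L y)"
    by (simp add: is_adjD[OF assms(1)])
qed

lemma is_adj_compose: "is_adj A A' \<Longrightarrow> is_adj B B' \<Longrightarrow> is_adj (A o\<^sub>L B) (B' o\<^sub>L A')"
  by (simp add: is_adj_def)

section \<open>Polynomials in an operator and the spectrum\<close>

text \<open>Padding with zero coefficients avoids a case split for \<open>pCons a p\<close>, whose
  degree is not \<open>Suc (degree p)\<close> when \<open>p = 0\<close>.\<close>

lemma op_poly_eq_sum:
  assumes "degree p \<le> n"
  shows "op_poly p A = (\<Sum>i\<le>n. coeff p i *\<^sub>R (((o\<^sub>L) A ^^ i) id_blinfun))"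
  unfolding op_poly_def
  by (rule sum.mono_neutral_left) (use assms in \<open>auto simp: coeff_eq_0\<close>)

lemma op_poly_0 [simp]: "op_poly 0 A = 0"
  by (simp add: op_poly_def)

lemma op_poly_pCons: "op_poly (pCons a p) A = a *\<^sub>R id_blinfun + (A o\<^sub>L op_poly p A)"
proof -
  have "op_poly (pCons a p) A =
      (\<Sum>i\<le>Suc (degree p). coeff (pCons a p) i *\<^sub>R (((o\<^sub>L) A ^^ i) id_blinfun))"
    by (rule op_poly_eq_sum) (simp add: degree_pCons_le)
  also have "\<dots> = a *\<^sub>R id_blinfun
      + (\<Sum>i\<le>degree p. coeff p i *\<^sub>R (A o\<^sub>L (((o\<^sub>L) A ^^ i) id_blinfun)))"
    by (simp add: sum.atMost_Suc_shift del: sum.atMost_Suc)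
  also have "(\<Sum>i\<le>degree p. coeff p i *\<^sub>R (A o\<^sub>L (((o\<^sub>L) A ^^ i) id_blinfun))) = A o\<^sub>L op_poly p A"
    by (simp add: op_poly_def bounded_bilinear.sum_right[OF bounded_bilinear_blinfun_compose]
        bounded_bilinear.scaleR_right[OF bounded_bilinear_blinfun_compose])
  finally show ?thesis .
qed

lemma op_poly_const: "op_poly [:a:] A = a *\<^sub>R id_blinfun"
  by (simp add: op_poly_pCons)

lemma op_poly_linear: "op_poly [:a, 1:] A = a *\<^sub>R id_blinfun + A"
  by (simp add: op_poly_pCons blinfun_eqI blinfun.add_left)

lemma op_poly_add: "op_poly (p + q) A = op_poly p A + op_poly q A"
  by (induction p q rule: poly_induct2)
     (simp_all add: op_poly_pCons bounded_bilinear.add_right[OF bounded_bilinear_blinfun_compose] scaleR_add_left)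

lemma op_poly_smult: "op_poly (smult c p) A = c *\<^sub>R op_poly p A"
  by (induction p) (simp_all add: op_poly_pCons bounded_bilinear.scaleR_right[OF bounded_bilinear_blinfun_compose]
      scaleR_add_right)

lemma op_poly_diff: "op_poly (p - q) A = op_poly p A - op_poly q A"
  using op_poly_add[of "p - q" q A] by simp

lemma op_poly_mult: "op_poly (p * q) A = op_poly p A o\<^sub>L op_poly q A"
proof (induction p)
  case 0
  then show ?case by simp
next
  case (pCons a p)
  show ?case
    by (rule blinfun_eqI)
       (simp add: op_poly_add op_poly_smult op_poly_pCons pCons.IH blinfun.add_left blinfun.scaleR_left)
qed

lemma op_poly_cblinfun: "A \<in> cblinfun \<Longrightarrow> op_poly p A \<in> cblinfun"
proof (induction p)
  case 0
  then show ?case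
    by (simp add: cblinfun_def linear_0[OF bounded_linear.linear[OF bounded_linear_scaleC]])
next
  case (pCons a p)
  then show ?case
    by (simp add: op_poly_pCons cblinfun_add cblinfun_scaleR cblinfun_compose id_blinfun_cblinfun)
qed

text \<open>Used in two ways: to move \<open>X\<close> past functions of
  \<open>adj X o\<^sub>L X\<close>, and with all three operators equal to see that \<open>A\<close>
  commutes with its polynomials.\<close>

lemma op_poly_intertwine:
  assumes "X o\<^sub>L A = B o\<^sub>L X"
  shows "X o\<^sub>L op_poly p A = op_poly p B o\<^sub>L X"
proof (induction p)
  case (pCons a p)
  have XA: "X (A x) = B (X x)" for x
    using arg_cong[OF assms, of "\<lambda>F. blinfun_apply F x"] by simp
  have "X (op_poly p A x) = op_poly p B (X x)" for x
    using arg_cong[OF pCons.IH, of "\<lambda>F. blinfun_apply F x"] by simp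
  then show ?case
    by (intro blinfun_eqI)
      (simp add: op_poly_pCons XA blinfun.add_left blinfun.scaleR_left blinfun.add_right blinfun.scaleR_right)
qed simp

lemma is_adj_op_poly:
  assumes "is_adj A A"
  shows "is_adj (op_poly p A) (op_poly p A)"
proof (induction p)
  case (pCons a p)
  have "A o\<^sub>L op_poly p A = op_poly p A o\<^sub>L A"
    by (rule op_poly_intertwine) simp
  then have "A (op_poly p A x) = op_poly p A (A x)" for x
    by (metis blinfun_apply_blinfun_compose)
  then have "inner (A (op_poly p A x)) y = inner x (A (op_poly p A y))" for x y
    by (simp add: is_adjD[OF assms] is_adjD[OF pCons.IH])
  then show ?case
    by (simp add: is_adj_def op_poly_pCons blinfun.add_left blinfun.scaleR_left inner_add_left inner_add_right)
qed (simp add: is_adj_def)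

section \<open>Lower bounds and the norm of a polynomial in an operator\<close>

definition bounded_below :: "('a::complex_hilbert \<Rightarrow>\<^sub>L 'b::complex_hilbert) \<Rightarrow> bool" where
  "bounded_below A \<longleftrightarrow> (\<exists>c>0. \<forall>x. c * norm x \<le> norm (blinfun_apply A x))"

lemma bounded_below_compose:
  assumes "bounded_below A" "bounded_below B"
  shows "bounded_below (A o\<^sub>L B)"
proof -
  obtain a b where a: "0 < a" "\<And>x. a * norm x \<le> norm (A x)"
    and b: "0 < b" "\<And>x. b * norm x \<le> norm (B x)"
    using assms by (auto simp: bounded_below_def)
  have "(a * b) * norm x \<le> norm (A (B x))" for x
    using order_trans[OF mult_left_mono[OF b(2)[of x], of a] a(2)[of "B x"]] a(1)
    by (simp add: mult.assoc)
  then show ?thesis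
    using a(1) b(1) by (auto simp: bounded_below_def intro!: exI[of _ "a * b"])
qed

lemma bounded_below_linear:
  assumes "complex_of_real t \<notin> op_spectrum A"
  shows "bounded_below (op_poly [:-t, 1:] A)"
proof -
  from assms obtain B where B: "\<And>x. blinfun_apply B (A x - t *\<^sub>R x) = x"
    by (auto simp: op_spectrum_def scaleC_of_real)
  \<comment> \<open>A left inverse \<open>B\<close> of \<open>A - t\<close> gives the lower bound.
    Adding 1 keeps the denominator positive even if \<open>norm B = 0\<close>.\<close>
  have "1 / (norm B + 1) * norm x \<le> norm (op_poly [:-t, 1:] A x)" for x
  proof -
    have "norm x \<le> norm B * norm (A x - t *\<^sub>R x)"
      using norm_blinfun[of B "A x - t *\<^sub>R x"] by (simp add: B)
    also have "\<dots> \<le> (norm B + 1) * norm (A x - t *\<^sub>R x)"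
      by (intro mult_right_mono) auto
    finally show ?thesis
      by (simp add: op_poly_linear blinfun.diff_left blinfun.scaleR_left divide_le_eq
          add_nonneg_pos mult.commute)
  qed
  then show ?thesis
    unfolding bounded_below_def by (intro exI[of _ "1 / (norm B + 1)"]) (simp add: add_nonneg_pos)
qed

text \<open>For self-adjoint \<open>A\<close> the quadratic form of \<open>(A - a)^2 + b^2\<close>
  at \<open>x\<close> is the squared norm of \<open>(A - a) x\<close> plus \<open>b^2\<close> times
  that of \<open>x\<close>; Cauchy-Schwarz turns this into a lower bound.\<close>

lemma bounded_below_quadratic:
  assumes "is_adj A A" "b \<noteq> 0"
  shows "bounded_below (op_poly ([:-a, 1:] * [:-a, 1:] + [:b\<^sup>2:]) A)"
proof -
  have "b\<^sup>2 * norm x \<le> norm (op_poly ([:-a, 1:] * [:-a, 1:] + [:b\<^sup>2:]) A x)" (is "_ \<le> norm ?y") for x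
  proof (cases "x = 0")
    case False
    let ?z = "op_poly [:-a, 1:] A x"
    have "b\<^sup>2 * norm x * norm x \<le> inner ?z ?z + b\<^sup>2 * inner x x"
      by (simp add: dot_square_norm power2_eq_square)
    also have "\<dots> = inner ?y x"
      unfolding op_poly_add op_poly_mult op_poly_const
      by (simp add: blinfun.add_left blinfun.scaleR_left inner_add_left
          is_adjD[OF is_adj_op_poly[OF assms(1)]])
    also have "\<dots> \<le> norm ?y * norm x"
      by (rule norm_cauchy_schwarz)
    finally show ?thesis
      using False by simp
  qed simp
  then show ?thesis
    unfolding bounded_below_def using assms(2) by (intro exI[of _ "b\<^sup>2"]) simp
qed

text \<open>A complex root \<open>a + ib\<close> of \<open>q\<close> is nonreal, and
  \<open>(t - a)^2 + b^2\<close> is its minimal polynomial over the reals: the remainder of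
  \<open>q\<close> has degree at most 1 and vanishes at a nonreal point, so it is zero.\<close>

lemma real_quadratic_factor:
  fixes q :: "real poly"
  assumes "degree q \<noteq> 0" "\<And>t. poly q t \<noteq> 0"
  obtains a b where "b \<noteq> 0" "([:-a, 1:] * [:-a, 1:] + [:b\<^sup>2:]) dvd q"
proof -
  let ?C = "map_poly complex_of_real"
  have "\<not> constant (poly (?C q))"
    using assms(1) by (simp add: constant_degree degree_map_poly)
  then obtain z where z: "poly (?C q) z = 0"
    using fundamental_theorem_of_algebra by blast
  \<comment> \<open>The next four facts make evaluation of the complexified polynomial a ring
    homomorphism, so that division with remainder over the reals can be evaluated at
    \<open>z\<close>.\<close>
  have poly_of_real: "poly (?C p) (complex_of_real t) = complex_of_real (poly p t)" for p t
    by (induction p) (simp_all add: map_poly_pCons)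
  have add: "poly (?C (p + r)) w = poly (?C p) w + poly (?C r) w" for p r w
    by (induction p r rule: poly_induct2) (simp_all add: map_poly_pCons algebra_simps)
  have smult: "poly (?C (smult a p)) w = complex_of_real a * poly (?C p) w" for a p w
    by (induction p) (simp_all add: map_poly_pCons algebra_simps)
  have mult: "poly (?C (p * r)) w = poly (?C p) w * poly (?C r) w" for p r w
  proof (induction p)
    case (pCons a p)
    then show ?case by (simp add: add smult map_poly_pCons algebra_simps)
  qed simp
  define a b where "a = Re z" and "b = Im z"
  have zab: "z = Complex a b" by (simp add: a_def b_def)
  have "b \<noteq> 0"
  proof
    assume "b = 0"
    then have "z = complex_of_real a" by (simp add: zab complex_eq_iff)
    then show False using z assms(2) by (simp add: poly_of_real)
  qed
  let ?m = "[:-a, 1:] * [:-a, 1:] + [:b\<^sup>2:]"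
  show thesis
  proof
    show "b \<noteq> 0" by fact
    have m0: "poly (?C ?m) z = 0"
      by (simp add: map_poly_pCons zab complex_eq_iff power2_eq_square algebra_simps)
    have "q = ?m * (q div ?m) + q mod ?m" by (rule mult_div_mod_eq[symmetric])
    then have "poly (?C q) z = poly (?C ?m) z * poly (?C (q div ?m)) z + poly (?C (q mod ?m)) z"
      by (metis add mult)
    then have r0: "poly (?C (q mod ?m)) z = 0"
      by (simp only: z m0 mult_zero_left add_0)
    have "?m \<noteq> 0" by simp
    then have "q mod ?m = 0 \<or> degree (q mod ?m) < degree ?m"
      by (rule degree_mod_less)
    then have "degree (q mod ?m) \<le> 1" by auto
    then have "q mod ?m = [:coeff (q mod ?m) 0, coeff (q mod ?m) 1:]"
      by (intro poly_eqI) (auto simp: coeff_pCons coeff_eq_0 split: nat.splits)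
    then obtain u v where uv: "q mod ?m = [:u, v:]" by blast
    \<comment> \<open>Real and imaginary parts of \<open>u + v * z = 0\<close>.\<close>
    then have "u + a * v = 0" "b = 0 \<or> v = 0"
      using r0 by (simp_all add: map_poly_pCons zab complex_eq_iff)
    then have "q mod ?m = 0" using \<open>b \<noteq> 0\<close> unfolding uv by simp
    then show "?m dvd q" by (simp only: dvd_eq_mod_eq_0)
  qed
qed

text \<open>Lower bounds survive composition, so it suffices to peel off one factor at a time: a
  linear one at a real root, which lies off the spectrum, or a quadratic one if there is no real
  root. Roots of the cofactor are roots of \<open>q\<close>, so the induction hypothesis
  applies.\<close>

lemma bounded_below_op_poly:
  assumes "is_adj A A" "q \<noteq> 0"
    and "\<And>t. poly q t = 0 \<Longrightarrow> complex_of_real t \<notin> op_spectrum A"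
  shows "bounded_below (op_poly q A)"
  using assms(2,3)
proof (induction "degree q" arbitrary: q rule: less_induct)
  case less
  show ?case
  proof (cases "\<exists>a. poly q a = 0")
    case True
    then obtain a where a: "poly q a = 0" ..
    then obtain s where s: "q = [:-a, 1:] * s"
      by (auto simp: poly_eq_0_iff_dvd)
    then have "s \<noteq> 0" using less.prems(1) by auto
    then have "degree q = Suc (degree s)"
      unfolding s by (subst degree_mult_eq) auto
    then have "bounded_below (op_poly s A)"
      using less.prems(2) \<open>s \<noteq> 0\<close> by (intro less.hyps) (auto simp: s)
    then show ?thesis
      unfolding s op_poly_mult
      by (intro bounded_below_compose bounded_below_linear less.prems(2) a)
  next
    case noroot: False
    show ?thesis
    proof (cases "degree q = 0")
      case True
      then obtain c where c: "q = [:c:]" by (rule degree_eq_zeroE)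
      then have "c \<noteq> 0" using less.prems by auto
      then show ?thesis
        unfolding c op_poly_const bounded_below_def
        by (intro exI[of _ "\<bar>c\<bar>"]) (simp add: blinfun.scaleR_left)
    next
      case False
      obtain a b where "b \<noteq> 0" "([:-a, 1:] * [:-a, 1:] + [:b\<^sup>2:]) dvd q"
        by (rule real_quadratic_factor[OF False]) (use noroot in auto)
      then obtain s where s: "q = ([:-a, 1:] * [:-a, 1:] + [:b\<^sup>2:]) * s" by (auto simp: dvd_def)
      then have "s \<noteq> 0" using less.prems(1) by auto
      then have "degree q = Suc (Suc (degree s))"
        unfolding s by (subst degree_mult_eq) auto
      then have "bounded_below (op_poly s A)"
        using less.prems(2) \<open>s \<noteq> 0\<close> by (intro less.hyps) (auto simp: s)
      then show ?thesis
        unfolding s op_poly_mult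
        by (intro bounded_below_compose bounded_below_quadratic assms(1) \<open>b \<noteq> 0\<close>)
    qed
  qed
qed

text \<open>If \<open>\<parallel>S\<parallel> = \<lambda>\<close>, the estimate \<open>\<parallel>(S\<^sup>2 - \<lambda>\<^sup>2) x\<parallel>\<^sup>2 \<le> \<lambda>\<^sup>2 (\<lambda>\<^sup>2 \<parallel>x\<parallel>\<^sup>2 - \<parallel>S x\<parallel>\<^sup>2)\<close> turns a lower
  bound for \<open>S\<^sup>2 - \<lambda>\<^sup>2\<close> into \<open>\<parallel>S\<parallel> < \<lambda>\<close>.\<close>

lemma not_bounded_below_norm:
  assumes "is_adj S S" "S \<noteq> 0"
    and "bounded_below (S - norm S *\<^sub>R id_blinfun)" "bounded_below (S + norm S *\<^sub>R id_blinfun)"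
  shows False
proof -
  define l where "l = norm S"
  have "0 < l" using assms(2) by (simp add: l_def)
  obtain c where c: "0 < c"
    "\<And>x. c * norm x \<le> norm (((S - norm S *\<^sub>R id_blinfun) o\<^sub>L (S + norm S *\<^sub>R id_blinfun)) x)"
    using bounded_below_compose[OF assms(3,4)] by (auto simp: bounded_below_def)
  have low: "c * norm x \<le> norm (S (S x) - (l * l) *\<^sub>R x)" for x
    using c(2)[of x]
    by (simp add: blinfun.add_left blinfun.diff_left blinfun.scaleR_left blinfun.add_right
        blinfun.scaleR_right algebra_simps flip: l_def)
  \<comment> \<open>The factor left after dividing the estimate of the introductory comment, with
    \<open>c\<close> as lower bound, by \<open>l^2\<close>.\<close>
  define k where "k = l\<^sup>2 - (c / l)\<^sup>2"
  have "(norm (S x))\<^sup>2 \<le> k * (norm x)\<^sup>2" for x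
  proof -
    have "(c * norm x)\<^sup>2 \<le> (norm (S (S x) - (l * l) *\<^sub>R x))\<^sup>2"
      using low c(1) by (intro power_mono) auto
    also have "\<dots> = (norm (S (S x)))\<^sup>2 - 2 * l\<^sup>2 * (norm (S x))\<^sup>2 + l\<^sup>2 * (l\<^sup>2 * (norm x)\<^sup>2)"
      unfolding power2_norm_eq_inner
      by (simp add: inner_diff_left inner_diff_right is_adjD[OF assms(1)]
          power2_eq_square algebra_simps)
    also have "(norm (S (S x)))\<^sup>2 \<le> l\<^sup>2 * (norm (S x))\<^sup>2"
      using power_mono[OF norm_blinfun[of S "S x"], of 2] by (simp add: l_def power_mult_distrib)
    finally have "c\<^sup>2 * (norm x)\<^sup>2 \<le> l\<^sup>2 * (l\<^sup>2 * (norm x)\<^sup>2 - (norm (S x))\<^sup>2)"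
      by (simp add: algebra_simps power_mult_distrib)
    then show ?thesis
      using \<open>0 < l\<close> by (simp add: k_def power_divide field_simps)
  qed
  note k = this
  \<comment> \<open>The sign of \<open>k\<close> is not known yet, and the operator norm bound asks
    for a nonnegative constant; a nonzero value of \<open>S\<close> settles the sign
    afterwards.\<close>
  have le: "norm (S x) \<le> sqrt \<bar>k\<bar> * norm x" for x
  proof -
    have "(norm (S x))\<^sup>2 \<le> \<bar>k\<bar> * (norm x)\<^sup>2"
      by (rule order_trans[OF k]) (simp add: mult_right_mono)
    then have "norm (S x) \<le> sqrt (\<bar>k\<bar> * (norm x)\<^sup>2)"
      by (rule real_le_rsqrt)
    then show ?thesis by (simp add: real_sqrt_mult)
  qed
  have "l \<le> sqrt \<bar>k\<bar>"
    unfolding l_def by (rule norm_blinfun_bound[OF _ le]) simp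
  obtain x where "S x \<noteq> 0"
    using assms(2) blinfun_eqI[of S 0] by auto
  then have "x \<noteq> 0" by auto
  have "0 \<le> k * (norm x)\<^sup>2"
    by (rule order_trans[OF zero_le_power2 k])
  then have "0 \<le> k"
    using \<open>x \<noteq> 0\<close> by (simp add: zero_le_mult_iff)
  moreover have "k < l\<^sup>2"
    using c(1) \<open>0 < l\<close> by (simp add: k_def)
  ultimately show False
    using power_mono[OF \<open>l \<le> sqrt \<bar>k\<bar>\<close>, of 2] \<open>0 < l\<close> by simp
qed

text \<open>If the norm exceeded \<open>e\<close>, then \<open>p\<close> could not take the values
  plus or minus that norm on the spectrum, so both shifts of \<open>p\<close> would be bounded
  below. Nonconstancy keeps the shifted polynomials nonzero.\<close>

lemma norm_op_poly_le_nonconstant: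
  assumes "is_adj A A" "0 \<le> e" "\<And>c. p \<noteq> [:c:]"
    and "\<And>t. complex_of_real t \<in> op_spectrum A \<Longrightarrow> \<bar>poly p t\<bar> \<le> e"
  shows "norm (op_poly p A) \<le> e"
proof (rule ccontr)
  let ?S = "op_poly p A"
  assume gt: "\<not> norm ?S \<le> e"
  have "bounded_below (op_poly (p - [:s * norm ?S:]) A)" if "\<bar>s\<bar> = 1" for s
  proof (rule bounded_below_op_poly[OF assms(1)])
    show "p - [:s * norm ?S:] \<noteq> 0"
      using assms(3) by simp
    show "complex_of_real t \<notin> op_spectrum A" if "poly (p - [:s * norm ?S:]) t = 0" for t
      using that gt assms(4)[of t] \<open>\<bar>s\<bar> = 1\<close> by (auto simp: abs_mult)
  qed
  from this[of 1] this[of "-1"] show False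
    using gt assms(2)
    by (intro not_bounded_below_norm[OF is_adj_op_poly[OF assms(1)], of p])
       (auto simp: op_poly_diff op_poly_const)
qed

section \<open>Nonemptiness and location of the real spectrum\<close>

lemma spectrum_nonempty:
  fixes A :: "'a::complex_hilbert \<Rightarrow>\<^sub>L 'a" and x :: 'a
  assumes "is_adj A A" "x \<noteq> 0"
  obtains t where "complex_of_real t \<in> op_spectrum A"
proof (rule ccontr)
  assume "\<not> thesis"
  then have empty: "complex_of_real t \<notin> op_spectrum A" for t
    using that by blast
  \<comment> \<open>With no real spectral point the previous bound holds with \<open>e = 0\<close>,
    so \<open>A = 0\<close>; but then 0 is in the spectrum.\<close>
  have "norm (op_poly [:0, 1:] A) \<le> 0"
    by (rule norm_op_poly_le_nonconstant[OF assms(1)]) (auto simp: empty)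
  then have "op_poly [:-0, 1:] A = 0" by simp
  then show False
    using bounded_below_linear[OF empty[of 0]] assms(2)
    by (auto simp: bounded_below_def mult_le_0_iff)
qed

text \<open>For constant \<open>p\<close> a spectral point is needed to compare the constant with
  \<open>e\<close>; on the zero space the operator itself vanishes.\<close>

lemma norm_op_poly_le:
  assumes "is_adj A A" "0 \<le> e"
    and "\<And>t. complex_of_real t \<in> op_spectrum A \<Longrightarrow> \<bar>poly p t\<bar> \<le> e"
  shows "norm (op_poly p A) \<le> e"
proof (cases "\<exists>c. p = [:c:]")
  case True
  then obtain c where c: "p = [:c:]" ..
  show ?thesis
  proof (cases "\<exists>x::'a. x \<noteq> 0")
    case True
    then obtain t where "complex_of_real t \<in> op_spectrum A"
      using spectrum_nonempty[OF assms(1)] by blast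
    then have "\<bar>c\<bar> \<le> e" using assms(3) c by force
    moreover have "norm (op_poly p A) \<le> \<bar>c\<bar> * 1"
      unfolding c op_poly_const norm_scaleR by (intro mult_left_mono norm_blinfun_id_le) simp
    ultimately show ?thesis by simp
  next
    case False
    then have "op_poly p A = 0"
      by (intro blinfun_eqI) metis
    then show ?thesis using assms(2) by simp
  qed
qed (use assms in \<open>auto intro: norm_op_poly_le_nonconstant\<close>)

text \<open>The geometric series of \<open>C\<close>. Shifting it by one index, with
  \<open>C\<close> factored out on either side, gives the two inverse identities.\<close>

lemma neumann_inverse:
  fixes C :: "'a::complex_hilbert \<Rightarrow>\<^sub>L 'a"
  assumes "norm C < 1" "C \<in> cblinfun"
  obtains S where "S \<in> cblinfun" "\<And>x. blinfun_apply S (x - C x) = x" "\<And>x. S x - C (S x) = x"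
proof -
  define P where "P n = (((o\<^sub>L) C ^^ n) id_blinfun)" for n
  have P_Suc: "P (Suc n) = C o\<^sub>L P n" for n by (simp add: P_def)
  have P_comm: "P (Suc n) = P n o\<^sub>L C" for n
    proof (induction n)
    case (Suc n)
    have "P (Suc (Suc n)) x = (P (Suc n) o\<^sub>L C) x" for x
    proof -
      have "P (Suc (Suc n)) x = C (P (Suc n) x)" by (simp only: P_Suc[of "Suc n"] blinfun_apply_blinfun_compose)
      also have "\<dots> = C (P n (C x))" by (simp only: Suc blinfun_apply_blinfun_compose)
      also have "\<dots> = P (Suc n) (C x)" by (simp only: P_Suc[of n] blinfun_apply_blinfun_compose)
      finally show ?thesis by simp
    qed
    then show ?case by (rule blinfun_eqI)
  qed (simp add: P_def blinfun_eqI)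
  have "norm (P n) \<le> norm C ^ n" for n
  proof (induction n)
    case 0
    then show ?case using norm_blinfun_id_le by (simp add: P_def)
  next
    case (Suc n)
    then show ?case
      unfolding P_Suc by (intro order_trans[OF norm_blinfun_compose]) (simp add: mult_left_mono)
  qed
  then have "summable P"
    by (intro summable_comparison_test'[OF summable_geometric[of "norm C"]]) (use assms in auto)
  then have sums: "P sums suminf P" by (rule summable_sums)
  let ?S = "suminf P"
  have shift: "(\<lambda>n. P (Suc n)) sums (?S - id_blinfun)"
    using sums by (subst sums_Suc_iff) (simp add: P_def)
  have "(\<lambda>n. P (Suc n)) sums (C o\<^sub>L ?S)"
    unfolding P_Suc by (rule bounded_linear.sums[OF bounded_bilinear.bounded_linear_right[OF bounded_bilinear_blinfun_compose] sums])
  then have right: "C o\<^sub>L ?S = ?S - id_blinfun"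
    using shift sums_unique2 by blast
  have "(\<lambda>n. P (Suc n)) sums (?S o\<^sub>L C)"
    unfolding P_comm by (rule bounded_linear.sums[OF bounded_bilinear.bounded_linear_left[OF bounded_bilinear_blinfun_compose] sums])
  then have left: "?S o\<^sub>L C = ?S - id_blinfun"
    using shift sums_unique2 by blast
  have L: "?S (x - C x) = x" for x
    using arg_cong[OF left, of "\<lambda>F. blinfun_apply F x"]
    by (simp add: blinfun.diff_left blinfun.diff_right)
  have R: "?S x - C (?S x) = x" for x
    using arg_cong[OF right, of "\<lambda>F. blinfun_apply F x"] by (simp add: blinfun.diff_left)
  \<comment> \<open>Both sides are mapped to \<open>c *\<^sub>C x\<close> by \<open>1 - C\<close>,
    which is injective by \<open>L\<close>.\<close>
  have "?S (c *\<^sub>C x) = c *\<^sub>C ?S x" for c x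
  proof -
    interpret bounded_linear "\<lambda>x::'a. c *\<^sub>C x" by (rule bounded_linear_scaleC)
    have "c *\<^sub>C ?S x - C (c *\<^sub>C ?S x) = c *\<^sub>C x"
      by (simp add: cblinfunD[OF assms(2)] R flip: diff)
    then show ?thesis using L[of "c *\<^sub>C ?S x"] by simp
  qed
  then have "?S \<in> cblinfun" by (simp add: cblinfun_def)
  then show thesis using L R that by blast
qed

lemma not_in_spectrumI:
  assumes "A \<in> cblinfun" "norm (A - m *\<^sub>R id_blinfun) < \<bar>t - m\<bar>"
  shows "complex_of_real t \<notin> op_spectrum A"
proof -
  define d where "d = t - m"
  have "d \<noteq> 0" using assms(2) norm_ge_zero[of "A - m *\<^sub>R id_blinfun"] unfolding d_def by linarith
  \<comment> \<open>Chosen so that \<open>A - t = - d (1 - C)\<close>; the hypothesis says exactly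
    that the Neumann series for \<open>C\<close> converges.\<close>
  define C where "C = (1 / d) *\<^sub>R (A + (- m) *\<^sub>R id_blinfun)"
  have "norm C < 1"
    using assms(2) \<open>d \<noteq> 0\<close> by (simp add: C_def d_def[symmetric])
  moreover have "C \<in> cblinfun"
    unfolding C_def by (intro cblinfun_scaleR cblinfun_add assms id_blinfun_cblinfun)
  ultimately obtain S where S: "S \<in> cblinfun" "\<And>x. blinfun_apply S (x - C x) = x" "\<And>x. S x - C (S x) = x"
    using neumann_inverse by blast
  have A: "A x - t *\<^sub>R x = (- d) *\<^sub>R (x - C x)" for x
    using \<open>d \<noteq> 0\<close>
    by (simp add: C_def blinfun.scaleR_left blinfun.add_left blinfun.diff_left scaleR_diff_right)
      (simp add: d_def algebra_simps)
  have "((- 1 / d) *\<^sub>R S) (A x - t *\<^sub>R x) = x \<and> A (((- 1 / d) *\<^sub>R S) x) - t *\<^sub>R ((- 1 / d) *\<^sub>R S) x = x" for x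
    unfolding A using \<open>d \<noteq> 0\<close>
    by (simp add: blinfun.scaleR_left blinfun.scaleR_right blinfun.diff_right blinfun.minus_left
        blinfun.minus_right S(2)[unfolded blinfun.diff_right] S(3) flip: scaleR_diff_right)
  moreover have "(- 1 / d) *\<^sub>R S \<in> cblinfun" by (intro cblinfun_scaleR S)
  ultimately show ?thesis
    unfolding op_spectrum_def by (auto simp: scaleC_of_real intro!: bexI[of _ "(- 1 / d) *\<^sub>R S"])
qed

text \<open>A single estimate gives both endpoints: \<open>D o\<^sub>L C\<close> is within
  \<open>M/2\<close> of \<open>M/2\<close> times the identity. On expanding the square, the cross
  term is \<open>- M\<close> times the squared norm of \<open>C x\<close>, which absorbs the squared
  norm of \<open>D (C x)\<close>.\<close>

lemma spectrum_adj_compose: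
  assumes "is_adj C D" "C \<in> cblinfun" "complex_of_real t \<in> op_spectrum (D o\<^sub>L C)"
  shows "t \<in> {0..(norm D)\<^sup>2}"
proof -
  define M where "M = (norm D)\<^sup>2"
  let ?A = "D o\<^sub>L C"
  have "norm (?A - (M/2) *\<^sub>R id_blinfun) \<le> M/2"
  proof (rule norm_blinfun_bound)
    show "0 \<le> M/2" by (simp add: M_def)
    fix x
    have eq: "(norm ((?A - (M/2) *\<^sub>R id_blinfun) x))\<^sup>2
        = (norm (D (C x)))\<^sup>2 - M * (norm (C x))\<^sup>2 + (M/2 * norm x)\<^sup>2"
      unfolding power_mult_distrib power2_norm_eq_inner
      by (simp add: blinfun.diff_left blinfun.scaleR_left inner_diff_left inner_diff_right
          is_adjD[OF assms(1)] is_adjD[OF is_adj_sym[OF assms(1)]]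
          power2_eq_square algebra_simps)
    have "(norm (D (C x)))\<^sup>2 \<le> M * (norm (C x))\<^sup>2"
      unfolding M_def using power_mono[OF norm_blinfun[of D "C x"], of 2] by (simp add: power_mult_distrib)
    then have "(norm ((?A - (M/2) *\<^sub>R id_blinfun) x))\<^sup>2 \<le> (M/2 * norm x)\<^sup>2"
      unfolding eq by linarith
    then show "norm ((?A - (M/2) *\<^sub>R id_blinfun) x) \<le> M/2 * norm x"
      by (rule power2_le_imp_le) (simp add: M_def)
  qed
  moreover have "?A \<in> cblinfun"
    by (rule cblinfun_compose[OF is_adj_cblinfun[OF assms(1,2)] assms(2)])
  ultimately have "\<bar>t - M/2\<bar> \<le> M/2"
    using not_in_spectrumI[of ?A "M/2" t] assms(3) by (meson not_le order.strict_trans1)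
  then have "0 \<le> t" "t \<le> M" by linarith+
  then show ?thesis by (simp add: M_def)
qed

section \<open>Continuous functional calculus\<close>

lemma polynomial_approximation:
  fixes f :: "real \<Rightarrow> real"
  assumes "compact S" "continuous_on S f"
  obtains p :: "nat \<Rightarrow> real poly" where "uniform_limit S (\<lambda>n. poly (p n)) f sequentially"
proof -
  obtain g where g: "uniform_limit S g f sequentially" "\<And>n. polynomial_function (g n)"
    using Stone_Weierstrass_uniform_limit[OF assms] by blast
  have "\<exists>p. g n = poly p" for n
  proof -
    have "real_polynomial_function (g n)"
      using g(2) by (simp add: real_polynomial_function_eq)
    then obtain a m where "g n = (\<lambda>x. \<Sum>i\<le>m. a i * x ^ i)"
      unfolding real_polynomial_function_iff_sum by blast
    then have "g n = poly (\<Sum>i\<le>m. monom (a i) i)"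
      by (simp add: fun_eq_iff poly_sum poly_monom)
    then show ?thesis ..
  qed
  then obtain p where "\<And>n. g n = poly (p n)" by metis
  then have "g = (\<lambda>n. poly (p n))" by (rule ext)
  then show thesis using that g(1) by simp
qed

lemma poly_fun_simps:
  fixes p q :: "'a::comm_ring_1 poly"
  shows "poly (p + q) = (\<lambda>t. poly p t + poly q t)"
    and "poly (p - q) = (\<lambda>t. poly p t - poly q t)"
    and "poly (p * q) = (\<lambda>t. poly p t * poly q t)"
  by (simp_all add: fun_eq_iff)

text \<open>\<open>M\<close> is any upper bound for the real spectrum, so that different operators
  can share the interval \<open>{0..M}\<close> and hence their approximating polynomials.\<close>

locale positive_operator =
  fixes A :: "'a::complex_hilbert \<Rightarrow>\<^sub>L 'a" and M :: real
  assumes cblinfun: "A \<in> cblinfun" and self_adjoint: "is_adj A A" and M_nonneg: "0 \<le> M"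
    and spectrum: "complex_of_real t \<in> op_spectrum A \<Longrightarrow> t \<in> {0..M}"
begin

abbreviation spec :: "real set" where
  "spec \<equiv> {t. complex_of_real t \<in> op_spectrum A}"

lemma op_poly_tendsto_0:
  assumes "uniform_limit spec (\<lambda>n. poly (p n)) (\<lambda>_. 0) sequentially"
  shows "(\<lambda>n. op_poly (p n) A) \<longlonglongrightarrow> 0"
proof (rule tendstoI)
  fix e :: real assume "0 < e"
  then have "\<forall>\<^sub>F n in sequentially. \<forall>t\<in>spec. dist (poly (p n) t) 0 < e/2"
    using assms by (intro uniform_limitD) auto
  then show "\<forall>\<^sub>F n in sequentially. dist (op_poly (p n) A) 0 < e"
  proof eventually_elim
    case (elim n)
    have "norm (op_poly (p n) A) \<le> e/2"
      using \<open>0 < e\<close> elim by (intro norm_op_poly_le[OF self_adjoint]) (auto intro: less_imp_le)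
    then show ?case using \<open>0 < e\<close> by simp
  qed
qed

lemma op_poly_convergent:
  assumes "uniform_limit spec (\<lambda>n. poly (p n)) f sequentially"
  shows "convergent (\<lambda>n. op_poly (p n) A)"
proof -
  have "Cauchy (\<lambda>n. op_poly (p n) A)"
  proof (rule metric_CauchyI)
    fix e :: real assume "0 < e"
    then obtain N where N: "\<And>n t. N \<le> n \<Longrightarrow> t \<in> spec \<Longrightarrow> dist (poly (p n) t) (f t) < e/4"
      using uniform_limitD[OF assms, of "e/4"] by (auto simp: eventually_sequentially)
    have "dist (op_poly (p m) A) (op_poly (p n) A) < e" if "N \<le> m" "N \<le> n" for m n
    proof -
      have "norm (op_poly (p m - p n) A) \<le> e/2"
      proof (rule norm_op_poly_le[OF self_adjoint])
        show "\<bar>poly (p m - p n) t\<bar> \<le> e/2" if "complex_of_real t \<in> op_spectrum A" for t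
          using dist_triangle2[of "poly (p m) t" "poly (p n) t" "f t"]
            N[OF \<open>N \<le> m\<close>, of t] N[OF \<open>N \<le> n\<close>, of t] that
          by (simp add: dist_real_def)
      qed (use \<open>0 < e\<close> in simp)
      then show ?thesis using \<open>0 < e\<close> by (simp add: dist_norm op_poly_diff)
    qed
    then show "\<exists>N. \<forall>m\<ge>N. \<forall>n\<ge>N. dist (op_poly (p m) A) (op_poly (p n) A) < e" by blast
  qed
  then show ?thesis by (rule Cauchy_convergent)
qed

lemma spec_subset: "spec \<subseteq> {0..M}"
  using spectrum by blast

text \<open>The description in \<open>cfc\<close> is well defined: two approximating sequences
  differ by polynomials tending to 0 uniformly on the spectrum. Uniqueness of the limit requires one
  actual sequence, which Weierstrass approximation supplies.\<close>

lemma cfc_tendsto_spec: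
  assumes "continuous_on {0..M} f" "uniform_limit spec (\<lambda>n. poly (p n)) f sequentially"
  shows "(\<lambda>n. op_poly (p n) A) \<longlonglongrightarrow> cfc f A"
proof -
  obtain q where "uniform_limit {0..M} (\<lambda>n. poly (q n)) f sequentially"
    using assms(1) by (rule polynomial_approximation[OF compact_Icc])
  then have q: "uniform_limit spec (\<lambda>n. poly (q n)) f sequentially"
    by (rule uniform_limit_on_subset[OF _ spec_subset])
  obtain L where L: "(\<lambda>n. op_poly (q n) A) \<longlonglongrightarrow> L"
    using op_poly_convergent[OF q] by (auto simp: convergent_def)
  have lim: "(\<lambda>n. op_poly (p n) A) \<longlonglongrightarrow> L"
    if p: "uniform_limit spec (\<lambda>n. poly (p n)) f sequentially" for p
  proof -
    have "(\<lambda>n. op_poly (p n - q n) A) \<longlonglongrightarrow> 0"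
      using uniform_limit_minus[OF p q] by (intro op_poly_tendsto_0) (simp add: poly_fun_simps)
    from tendsto_add[OF this L] show ?thesis by (simp add: op_poly_diff)
  qed
  have "cfc f A = L"
    unfolding cfc_def
  proof (rule the_equality)
    show "B = L" if "\<forall>p. uniform_limit spec (\<lambda>n. poly (p n)) f sequentially
        \<longrightarrow> (\<lambda>n. op_poly (p n) A) \<longlonglongrightarrow> B" for B
      using that q L LIMSEQ_unique by blast
  qed (use lim in blast)
  then show ?thesis using lim[OF assms(2)] by simp
qed

lemma cfc_tendsto:
  assumes "continuous_on {0..M} f" "uniform_limit {0..M} (\<lambda>n. poly (p n)) f sequentially"
  shows "(\<lambda>n. op_poly (p n) A) \<longlonglongrightarrow> cfc f A"
  by (rule cfc_tendsto_spec[OF assms(1) uniform_limit_on_subset[OF assms(2) spec_subset]])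

lemma cfc_approx:
  assumes "continuous_on {0..M} f"
  obtains p where "uniform_limit {0..M} (\<lambda>n. poly (p n)) f sequentially"
    "(\<lambda>n. op_poly (p n) A) \<longlonglongrightarrow> cfc f A"
  using polynomial_approximation[OF compact_Icc assms] cfc_tendsto[OF assms] by metis

lemma cfc_eqI:
  assumes "continuous_on {0..M} f" "uniform_limit {0..M} (\<lambda>n. poly (p n)) f sequentially"
    "(\<lambda>n. op_poly (p n) A) \<longlonglongrightarrow> L"
  shows "cfc f A = L"
  using LIMSEQ_unique[OF cfc_tendsto[OF assms(1,2)] assms(3)] .

lemma cfc_cong:
  assumes "continuous_on {0..M} f" "\<And>t. 0 \<le> t \<Longrightarrow> t \<le> M \<Longrightarrow> f t = g t"
  shows "cfc f A = cfc g A"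
proof -
  obtain p where p: "uniform_limit {0..M} (\<lambda>n. poly (p n)) g sequentially"
      "(\<lambda>n. op_poly (p n) A) \<longlonglongrightarrow> cfc g A"
    using assms by (metis cfc_approx continuous_on_cong atLeastAtMost_iff)
  moreover have "uniform_limit {0..M} (\<lambda>n. poly (p n)) f sequentially
      \<longleftrightarrow> uniform_limit {0..M} (\<lambda>n. poly (p n)) g sequentially"
    by (rule uniform_limit_cong') (use assms(2) in auto)
  ultimately show ?thesis by (intro cfc_eqI[OF assms(1)]) auto
qed

lemma cfc_poly: "cfc (poly p) A = op_poly p A"
  by (rule cfc_eqI[where p = "\<lambda>_. p"]) (auto intro!: continuous_intros uniform_limit_const)

section \<open>Algebra, norm and order properties of the functional calculus\<close>

lemma cfc_const: "cfc (\<lambda>_. c) A = c *\<^sub>R id_blinfun"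
proof -
  have "poly [:c:] = (\<lambda>_. c)" by (simp add: fun_eq_iff)
  then show ?thesis using cfc_poly[of "[:c:]"] by (simp add: op_poly_const)
qed

lemma cfc_ident: "cfc (\<lambda>t. t) A = A"
proof -
  have "poly [:0, 1:] = (\<lambda>t::real. t)" by (simp add: fun_eq_iff)
  then show ?thesis using cfc_poly[of "[:0, 1:]"] by (simp add: op_poly_linear)
qed

lemma cfc_add:
  assumes f: "continuous_on {0..M} f" and g: "continuous_on {0..M} g"
  shows "cfc (\<lambda>t. f t + g t) A = cfc f A + cfc g A"
proof -
  obtain p q where p: "uniform_limit {0..M} (\<lambda>n. poly (p n)) f sequentially"
      "(\<lambda>n. op_poly (p n) A) \<longlonglongrightarrow> cfc f A"
    and q: "uniform_limit {0..M} (\<lambda>n. poly (q n)) g sequentially"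
      "(\<lambda>n. op_poly (q n) A) \<longlonglongrightarrow> cfc g A"
    using cfc_approx[OF f] cfc_approx[OF g] by metis
  show ?thesis
    by (rule cfc_eqI[where p = "\<lambda>n. p n + q n"])
       (use uniform_limit_add[OF p(1) q(1)] tendsto_add[OF p(2) q(2)] f g
         in \<open>auto simp: op_poly_add poly_fun_simps intro: continuous_intros\<close>)
qed

lemma cfc_mult:
  assumes f: "continuous_on {0..M} f" and g: "continuous_on {0..M} g"
  shows "cfc (\<lambda>t. f t * g t) A = cfc f A o\<^sub>L cfc g A"
proof -
  obtain p q where p: "uniform_limit {0..M} (\<lambda>n. poly (p n)) f sequentially"
      "(\<lambda>n. op_poly (p n) A) \<longlonglongrightarrow> cfc f A"
    and q: "uniform_limit {0..M} (\<lambda>n. poly (q n)) g sequentially"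
      "(\<lambda>n. op_poly (q n) A) \<longlonglongrightarrow> cfc g A"
    using cfc_approx[OF f] cfc_approx[OF g] by metis
  have "bounded (f ` {0..M})" "bounded (g ` {0..M})"
    by (intro compact_imp_bounded compact_continuous_image f g compact_Icc)+
  then have "uniform_limit {0..M} (\<lambda>n t. poly (p n) t * poly (q n) t) (\<lambda>t. f t * g t) sequentially"
    by (rule uniform_lim_mult[OF p(1) q(1)])
  moreover have "(\<lambda>n. op_poly (p n) A o\<^sub>L op_poly (q n) A) \<longlonglongrightarrow> (cfc f A o\<^sub>L cfc g A)"
    by (rule bounded_bilinear.tendsto[OF bounded_bilinear_blinfun_compose p(2) q(2)])
  ultimately show ?thesis
    by (intro cfc_eqI[where p = "\<lambda>n. p n * q n"])
       (use f g in \<open>auto simp: op_poly_mult poly_fun_simps intro: continuous_intros\<close>)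
qed

lemma cfc_scale:
  assumes "continuous_on {0..M} f"
  shows "cfc (\<lambda>t. c * f t) A = c *\<^sub>R cfc f A"
  using cfc_mult[OF continuous_on_const assms, of c]
  by (simp add: cfc_const blinfun_eqI blinfun.scaleR_left)

lemma cfc_diff:
  assumes "continuous_on {0..M} f" "continuous_on {0..M} g"
  shows "cfc (\<lambda>t. f t - g t) A = cfc f A - cfc g A"
  using cfc_add[OF assms(1) continuous_on_mult_left[OF assms(2), of "-1"]] cfc_scale[OF assms(2), of "-1"]
  by simp

lemma cfc_cblinfun:
  assumes "continuous_on {0..M} f"
  shows "cfc f A \<in> cblinfun"
proof -
  obtain p where "(\<lambda>n. op_poly (p n) A) \<longlonglongrightarrow> cfc f A" using cfc_approx[OF assms] .
  then show ?thesis
    by (rule cblinfun_LIMSEQ[rotated]) (intro op_poly_cblinfun cblinfun)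
qed

lemma is_adj_cfc:
  assumes "continuous_on {0..M} f"
  shows "is_adj (cfc f A) (cfc f A)"
proof -
  obtain p where p: "(\<lambda>n. op_poly (p n) A) \<longlonglongrightarrow> cfc f A" using cfc_approx[OF assms] .
  show ?thesis
    by (rule is_adj_LIMSEQ[OF _ p p]) (intro is_adj_op_poly self_adjoint)
qed

lemma norm_cfc_le:
  assumes f: "continuous_on {0..M} f" and e: "0 \<le> e"
    and le: "\<And>t. 0 \<le> t \<Longrightarrow> t \<le> M \<Longrightarrow> \<bar>f t\<bar> \<le> e"
  shows "norm (cfc f A) \<le> e"
proof (rule field_le_epsilon)
  fix d :: real assume "0 < d"
  obtain p where p: "uniform_limit {0..M} (\<lambda>n. poly (p n)) f sequentially"
      "(\<lambda>n. op_poly (p n) A) \<longlonglongrightarrow> cfc f A"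
    using cfc_approx[OF f] .
  have "\<forall>\<^sub>F n in sequentially. norm (op_poly (p n) A) \<le> e + d"
    using uniform_limitD[OF p(1) \<open>0 < d\<close>]
  proof eventually_elim
    case (elim n)
    have "\<bar>poly (p n) t\<bar> \<le> e + d" if "complex_of_real t \<in> op_spectrum A" for t
    proof -
      have "t \<in> {0..M}" using that by (rule spectrum)
      then have "\<bar>poly (p n) t - f t\<bar> < d" "\<bar>f t\<bar> \<le> e"
        using elim le[of t] by (auto simp: dist_real_def)
      then show ?thesis by linarith
    qed
    then show ?case
      using e \<open>0 < d\<close> by (intro norm_op_poly_le[OF self_adjoint]) auto
  qed
  then show "norm (cfc f A) \<le> e + d"
    by (rule tendsto_upperbound[OF tendsto_norm[OF p(2)]]) simp
qed

text \<open>Needed for composition, where the approximants are polynomials in \<open>f t\<close> and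
  not in \<open>t\<close>.\<close>

lemma cfc_uniform_limit:
  assumes "\<And>n. continuous_on {0..M} (h n)" "continuous_on {0..M} f"
    and "uniform_limit {0..M} h f sequentially"
  shows "(\<lambda>n. cfc (h n) A) \<longlonglongrightarrow> cfc f A"
proof (rule tendstoI)
  fix e :: real assume "0 < e"
  then have "\<forall>\<^sub>F n in sequentially. \<forall>t\<in>{0..M}. dist (h n t) (f t) < e/2"
    using assms(3) by (intro uniform_limitD) auto
  then show "\<forall>\<^sub>F n in sequentially. dist (cfc (h n) A) (cfc f A) < e"
  proof eventually_elim
    case (elim n)
    have "norm (cfc (\<lambda>t. h n t - f t) A) \<le> e/2"
      using \<open>0 < e\<close> elim assms
      by (intro norm_cfc_le) (auto intro!: continuous_intros less_imp_le simp: dist_real_def)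
    then show ?case using \<open>0 < e\<close> by (simp add: dist_norm cfc_diff assms)
  qed
qed

lemma inner_cfc_square:
  assumes "continuous_on {0..M} f"
  shows "inner (cfc (\<lambda>t. f t * f t) A x) x = (norm (cfc f A x))\<^sup>2"
  by (simp add: cfc_mult[OF assms assms] power2_norm_eq_inner is_adjD[OF is_adj_cfc[OF assms]])

text \<open>A nonnegative function is the square of its root, and the form of a square is a squared
  norm.\<close>

lemma inner_cfc_nonneg:
  assumes "continuous_on {0..M} f" "\<And>t. 0 \<le> t \<Longrightarrow> t \<le> M \<Longrightarrow> 0 \<le> f t"
  shows "0 \<le> inner (cfc f A x) x"
proof -
  have c: "continuous_on {0..M} (\<lambda>t. sqrt (f t))"
    by (intro continuous_intros assms(1))
  have "cfc f A = cfc (\<lambda>t. sqrt (f t) * sqrt (f t)) A"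
    by (rule cfc_cong[OF assms(1)]) (simp add: assms(2))
  then show ?thesis by (simp only: inner_cfc_square[OF c] zero_le_power2)
qed

lemma inner_cfc_mono:
  assumes "continuous_on {0..M} f" "continuous_on {0..M} g"
    and "\<And>t. 0 \<le> t \<Longrightarrow> t \<le> M \<Longrightarrow> f t \<le> g t"
  shows "inner (cfc f A x) x \<le> inner (cfc g A x) x"
proof -
  have "0 \<le> inner (cfc (\<lambda>t. g t - f t) A x) x"
    using assms by (intro inner_cfc_nonneg continuous_intros) auto
  then show ?thesis by (simp add: cfc_diff assms blinfun.diff_left inner_diff_left)
qed

end

section \<open>Composition and intertwining in the functional calculus\<close>

lemma positive_operator_adj_compose:
  assumes "is_adj C D" "C \<in> cblinfun" "(norm D)\<^sup>2 \<le> M"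
  shows "positive_operator (D o\<^sub>L C) M"
proof
  show "D o\<^sub>L C \<in> cblinfun"
    by (rule cblinfun_compose[OF is_adj_cblinfun[OF assms(1,2)] assms(2)])
  show "is_adj (D o\<^sub>L C) (D o\<^sub>L C)"
    by (rule is_adj_compose[OF is_adj_sym[OF assms(1)] assms(1)])
  show "0 \<le> M" by (rule order_trans[OF zero_le_power2 assms(3)])
  show "t \<in> {0..M}" if "complex_of_real t \<in> op_spectrum (D o\<^sub>L C)" for t
    using spectrum_adj_compose[OF assms(1,2) that] assms(3) by simp
qed

text \<open>To apply the calculus to \<open>cfc f A\<close>, it is written as
  \<open>R o\<^sub>L R\<close> with self-adjoint \<open>R\<close>, which makes it a positive
  operator. The identity is clear for polynomials \<open>h\<close> and passes to uniform
  limits.\<close>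

lemma (in positive_operator) cfc_compose:
  assumes f: "continuous_on {0..M} f" "\<And>t. 0 \<le> t \<Longrightarrow> t \<le> M \<Longrightarrow> 0 \<le> f t"
    and h: "continuous_on {0..} h"
  shows "cfc h (cfc f A) = cfc (\<lambda>t. h (f t)) A"
proof -
  define R where "R = cfc (\<lambda>t. sqrt (f t)) A"
  have c: "continuous_on {0..M} (\<lambda>t. sqrt (f t))"
    by (intro continuous_intros f(1))
  have "bounded (f ` {0..M})"
    by (intro compact_imp_bounded compact_continuous_image f(1) compact_Icc)
  then obtain b where b: "\<And>t. t \<in> {0..M} \<Longrightarrow> \<bar>f t\<bar> \<le> b"
    by (force simp: bounded_iff)
  \<comment> \<open>The interval must contain both the spectrum of \<open>cfc f A\<close> and the
    range of \<open>f\<close>, so that approximation of \<open>h\<close> on it controls both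
    sides.\<close>
  define K where "K = max b ((norm R)\<^sup>2)"
  have "cfc f A = cfc (\<lambda>t. sqrt (f t) * sqrt (f t)) A"
    by (rule cfc_cong[OF f(1)]) (simp add: f(2))
  then have "cfc f A = R o\<^sub>L R" by (simp only: R_def cfc_mult[OF c c])
  moreover have "positive_operator (R o\<^sub>L R) K"
    by (rule positive_operator_adj_compose) (simp_all add: R_def K_def is_adj_cfc cfc_cblinfun c)
  ultimately interpret B: positive_operator "cfc f A" K by simp
  have range: "f t \<in> {0..K}" if "t \<in> {0..M}" for t
    using that b[of t] f(2)[of t] by (auto simp: K_def)
  have h': "continuous_on {0..K} h"
    by (rule continuous_on_subset[OF h]) auto
  have comp: "continuous_on {0..M} (\<lambda>t. k (f t))" if "continuous_on {0..K} k" for k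
    by (rule continuous_on_compose2[OF that f(1)]) (use range in auto)
  have poly: "op_poly q (cfc f A) = cfc (\<lambda>t. poly q (f t)) A" for q
  proof (induction q)
    case 0
    show ?case using cfc_const[of 0] by simp
  next
    case (pCons a q)
    have q: "continuous_on {0..M} (\<lambda>t. poly q (f t))"
      by (intro comp continuous_intros)
    show ?case
      by (simp add: op_poly_pCons pCons.IH cfc_add[OF continuous_on_const continuous_on_mult[OF f(1) q]]
          cfc_const cfc_mult[OF f(1) q])
  qed
  obtain q where q: "uniform_limit {0..K} (\<lambda>n. poly (q n)) h sequentially"
      "(\<lambda>n. op_poly (q n) (cfc f A)) \<longlonglongrightarrow> cfc h (cfc f A)"
    using B.cfc_approx[OF h'] .
  have "(\<lambda>n. cfc (\<lambda>t. poly (q n) (f t)) A) \<longlonglongrightarrow> cfc (\<lambda>t. h (f t)) A"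
  proof (rule cfc_uniform_limit)
    show "uniform_limit {0..M} (\<lambda>n t. poly (q n) (f t)) (\<lambda>t. h (f t)) sequentially"
      by (rule uniform_limit_compose'[OF q(1)]) (use range in auto)
  qed (intro comp h' continuous_intros)+
  then show ?thesis
    using q(2) LIMSEQ_unique unfolding poly by blast
qed

lemma cfc_intertwine:
  assumes "positive_operator A M" "positive_operator B M"
    and X: "X o\<^sub>L A = B o\<^sub>L X" and f: "continuous_on {0..M} f"
  shows "X o\<^sub>L cfc f A = cfc f B o\<^sub>L X"
proof -
  interpret A: positive_operator A M by fact
  interpret B: positive_operator B M by fact
  obtain p where p: "uniform_limit {0..M} (\<lambda>n. poly (p n)) f sequentially"
      "(\<lambda>n. op_poly (p n) A) \<longlonglongrightarrow> cfc f A"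
    using A.cfc_approx[OF f] .
  have "(\<lambda>n. X o\<^sub>L op_poly (p n) A) \<longlonglongrightarrow> (X o\<^sub>L cfc f A)"
    by (intro bounded_bilinear.tendsto[OF bounded_bilinear_blinfun_compose] tendsto_const p)
  moreover have "(\<lambda>n. op_poly (p n) B o\<^sub>L X) \<longlonglongrightarrow> (cfc f B o\<^sub>L X)"
    by (intro bounded_bilinear.tendsto[OF bounded_bilinear_blinfun_compose] tendsto_const
        B.cfc_tendsto f p)
  ultimately show ?thesis
    unfolding op_poly_intertwine[OF X] by (rule LIMSEQ_unique)
qed

section \<open>Operator inequalities\<close>

text \<open>Convexity is used on the open half-line; at \<open>x = 0\<close> the tangent has value
  \<open>(1 - r) * c powr r\<close>, which is not positive.\<close>

lemma powr_above_tangent: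
  fixes x c r :: real
  assumes "0 \<le> x" "0 < c" "1 \<le> r"
  shows "c powr r + r * c powr (r - 1) * (x - c) \<le> x powr r"
proof (cases "x = 0")
  case True
  have "c powr (r - 1) * c = c powr r"
    using assms(2) by (simp add: powr_diff)
  then show ?thesis
    using True assms by (simp add: mult.assoc)
next
  case False
  have "((\<lambda>x. x powr r) has_real_derivative r * c powr (r - 1)) (at c within {0<..})"
    using assms(2) by (auto intro!: derivative_eq_intros)
  then have "r * c powr (r - 1) * (x - c) \<le> x powr r - c powr r"
    using assms False
    by (intro convex_on_imp_above_tangent[OF powr_convex[OF assms(3)]])
       (auto simp: interior_open intro: convex_connected)
  then show ?thesis by simp
qed

text \<open>Add the tangent inequalities at the midpoint of \<open>a\<close> and \<open>b\<close>:
  the linear terms cancel.\<close>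

lemma powr_add_le:
  fixes a b r :: real
  assumes "0 \<le> a" "0 \<le> b" "1 \<le> r"
  shows "(a + b) powr r \<le> 2 powr (r - 1) * (a powr r + b powr r)"
proof (cases "a + b = 0")
  case False
  define c where "c = (a + b) / 2"
  have "0 < c" using False assms by (simp add: c_def)
  have "c powr r + r * c powr (r - 1) * (a - c) + (c powr r + r * c powr (r - 1) * (b - c))
      \<le> a powr r + b powr r"
    by (intro add_mono powr_above_tangent assms \<open>0 < c\<close>)
  moreover have "r * c powr (r - 1) * (a - c) + r * c powr (r - 1) * (b - c) = 0"
    unfolding c_def by (simp add: algebra_simps flip: distrib_left)
  ultimately have le: "2 * c powr r \<le> a powr r + b powr r" by linarith
  have "(a + b) powr r = 2 powr (r - 1) * (2 * c powr r)"
    using assms by (simp add: c_def powr_divide powr_diff)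
  then show ?thesis using le by simp
qed (use assms in simp)

context positive_operator
begin

text \<open>For \<open>A = adj X o\<^sub>L X\<close> the left side is the squared norm of
  \<open>X (cfc h A x)\<close>, so operator norms reduce to scalar inequalities.\<close>

lemma inner_sandwich_cfc:
  assumes "continuous_on {0..M} h"
  shows "inner (A (cfc h A x)) (cfc h A x) = inner (cfc (\<lambda>t. h t * (t * h t)) A x) x"
proof -
  have "continuous_on {0..M} (\<lambda>t. t * h t)"
    by (intro continuous_intros assms)
  then have "cfc (\<lambda>t. h t * (t * h t)) A = cfc h A o\<^sub>L (A o\<^sub>L cfc h A)"
    using cfc_mult[OF continuous_on_id assms] by (simp add: cfc_mult assms cfc_ident)
  then show ?thesis
    by (simp add: is_adjD[OF is_adj_cfc[OF assms]])
qed

text \<open>McCarthy's inequality: integrate the tangent line of \<open>t powr r\<close> at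
  \<open>m = \<langle>\<phi>(A) x, x\<rangle>\<close> against the spectral measure of \<open>x\<close>.\<close>

lemma inner_cfc_powr_le:
  assumes \<phi>: "continuous_on {0..M} \<phi>" "\<And>t. 0 \<le> t \<Longrightarrow> t \<le> M \<Longrightarrow> 0 \<le> \<phi> t"
    and r: "1 \<le> r" and x: "norm x \<le> 1"
  shows "inner (cfc \<phi> A x) x powr r \<le> inner (cfc (\<lambda>t. \<phi> t powr r) A x) x"
proof -
  define m where "m = inner (cfc \<phi> A x) x"
  have cont: "continuous_on {0..M} (\<lambda>t. \<phi> t powr r)"
    using \<phi> r by (intro continuous_on_powr' continuous_on_const) auto
  have "0 \<le> m" unfolding m_def by (rule inner_cfc_nonneg[OF \<phi>])
  show ?thesis
  proof (cases "m = 0")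
    case True
    then show ?thesis
      using inner_cfc_nonneg[OF cont, of x] by (simp flip: m_def)
  next
    case False
    then have "0 < m" using \<open>0 \<le> m\<close> by simp
    define s where "s = r * m powr (r - 1)"
    have s: "s * m = r * m powr r"
      using \<open>0 < m\<close> by (simp add: s_def powr_diff)
    \<comment> \<open>The constant part of the tangent is \<open>(1 - r) * m powr r\<close>, not
      positive, so vectors of norm below 1 are covered too.\<close>
    have "m powr r \<le> (m powr r - s * m) * (norm x)\<^sup>2 + s * m"
    proof -
      have "(norm x)\<^sup>2 \<le> 1" using x by (simp add: power_le_one)
      moreover have "m powr r - s * m \<le> 0"
        using r \<open>0 < m\<close> unfolding s by simp
      ultimately have "(m powr r - s * m) * 1 \<le> (m powr r - s * m) * (norm x)\<^sup>2"
        by (intro mult_left_mono_neg)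
      then show ?thesis by simp
    qed
    also have "\<dots> = inner (cfc (\<lambda>t. (m powr r - s * m) + s * \<phi> t) A x) x"
      using \<phi>(1)
      by (subst cfc_add)
         (auto intro!: continuous_intros simp: cfc_const cfc_scale blinfun.add_left blinfun.scaleR_left
           inner_add_left power2_norm_eq_inner m_def)
    also have "\<dots> \<le> inner (cfc (\<lambda>t. \<phi> t powr r) A x) x"
    proof (rule inner_cfc_mono)
      show "(m powr r - s * m) + s * \<phi> t \<le> \<phi> t powr r" if "0 \<le> t" "t \<le> M" for t
        using powr_above_tangent[OF \<phi>(2)[OF that] \<open>0 < m\<close> r] by (simp add: s_def algebra_simps)
    qed (intro cont continuous_intros \<phi>)+
    finally show ?thesis by (simp flip: m_def)
  qed
qed

lemma norm_cfc_powr_le: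
  assumes F: "continuous_on {0..M} F" "\<And>t. 0 \<le> t \<Longrightarrow> t \<le> M \<Longrightarrow> 0 \<le> F t"
    and r: "1 \<le> r" and x: "norm x \<le> 1"
  shows "norm (cfc F A x) powr r \<le> sqrt (inner (cfc (\<lambda>t. F t powr (2 * r)) A x) x)"
proof (rule real_le_rsqrt)
  have "(norm (cfc F A x) powr r)\<^sup>2 = ((norm (cfc F A x))\<^sup>2) powr r"
    by (simp add: power2_eq_square powr_mult)
  also have "\<dots> = inner (cfc (\<lambda>t. F t * F t) A x) x powr r"
    by (simp only: inner_cfc_square[OF F(1)])
  also have "\<dots> \<le> inner (cfc (\<lambda>t. (F t * F t) powr r) A x) x"
    using F by (intro inner_cfc_powr_le r x) (auto intro!: continuous_intros)
  also have "cfc (\<lambda>t. (F t * F t) powr r) A = cfc (\<lambda>t. F t powr (2 * r)) A"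
  proof (rule cfc_cong)
    show "continuous_on {0..M} (\<lambda>t. (F t * F t) powr r)"
      using F r by (intro continuous_on_powr' continuous_on_mult continuous_on_const) auto
    show "(F t * F t) powr r = F t powr (2 * r)" if "0 \<le> t" "t \<le> M" for t
      using F(2)[OF that] by (simp add: powr_mult flip: powr_add)
  qed
  finally show "(norm (cfc F A x) powr r)\<^sup>2 \<le> inner (cfc (\<lambda>t. F t powr (2 * r)) A x) x" .
qed

end

section \<open>Gram operators and the mixed Schwarz inequality\<close>

lemma positive_operator_gram:
  assumes "X \<in> cblinfun" "(norm (adj X))\<^sup>2 \<le> M"
  shows "positive_operator (adj X o\<^sub>L X) M"
  by (rule positive_operator_adj_compose[OF is_adj_adj[OF assms(1)] assms])

lemma positive_operator_gram_adj:
  assumes "X \<in> cblinfun" "(norm X)\<^sup>2 \<le> M"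
  shows "positive_operator (X o\<^sub>L adj X) M"
  by (rule positive_operator_adj_compose[OF is_adj_sym[OF is_adj_adj[OF assms(1)]] adj_cblinfun[OF assms(1)] assms(2)])

text \<open>Root, \<open>f\<close> and power collapse into one function of
  \<open>adj X o\<^sub>L X\<close>, by composition applied twice.\<close>

lemma op_powr_cfc_abs_op:
  assumes X: "X \<in> cblinfun" and f: "continuous_on {0..} f" "\<And>t. 0 \<le> t \<Longrightarrow> 0 \<le> f t" and s: "0 < s"
  shows "op_powr (cfc f (abs_op X)) s = cfc (\<lambda>t. f (sqrt t) powr s) (adj X o\<^sub>L X)"
proof -
  interpret positive_operator "adj X o\<^sub>L X" "(norm (adj X))\<^sup>2"
    by (rule positive_operator_gram[OF X order_refl])
  have fsqrt: "continuous_on {0..(norm (adj X))\<^sup>2} (\<lambda>t. f (sqrt t))"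
    by (rule continuous_on_compose2[OF f(1)]) (auto intro!: continuous_intros)
  have "continuous_on {0::real..} (\<lambda>t. t powr s)"
    using s by (intro continuous_on_powr' continuous_intros) auto
  moreover have "continuous_on {0..(norm (adj X))\<^sup>2} sqrt"
    by (intro continuous_intros)
  ultimately show ?thesis
    unfolding op_powr_def abs_op_def
    by (subst cfc_compose[OF _ _ f(1)]) (auto intro!: cfc_compose fsqrt f)
qed

text \<open>With \<open>h(t) = G(t) \<surd>t / (t + \<epsilon>\<^sup>2)\<close> one has \<open>\<surd>t h(t) \<le> G(t)\<close> and \<open>h(t) F(t) = t / (t + \<epsilon>\<^sup>2)\<close>, so
  \<open>X h(X\<^sup>*X) F(X\<^sup>*X)\<close> approximates \<open>X\<close> up to \<open>\<epsilon>\<close>; this replaces the polar decomposition.\<close>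

lemma mixed_schwarz_approx:
  assumes X: "X \<in> cblinfun" and F: "continuous_on {0..} F" and G: "continuous_on {0..} G"
    and FG: "\<And>t. 0 \<le> t \<Longrightarrow> F t * G t = sqrt t" and e: "0 < e"
  shows "inner (X u) v \<le> norm (cfc F (adj X o\<^sub>L X) u) * norm (cfc G (X o\<^sub>L adj X) v)
    + e * norm u * norm v"
proof -
  define N where "N = adj X o\<^sub>L X"
  define N' where "N' = X o\<^sub>L adj X"
  \<comment> \<open>One bound for both Gram operators, as intertwining requires a common
    interval.\<close>
  define M where "M = max ((norm X)\<^sup>2) ((norm (adj X))\<^sup>2)"
  interpret N: positive_operator N M
    unfolding N_def by (rule positive_operator_gram[OF X]) (simp add: M_def)
  interpret N': positive_operator N' M
    unfolding N'_def by (rule positive_operator_gram_adj[OF X]) (simp add: M_def)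
  have FM: "continuous_on {0..M} F" and GM: "continuous_on {0..M} G"
    using F G by (auto intro: continuous_on_subset)
  define h where "h t = G t * sqrt t / (t + e\<^sup>2)" for t
  define k where "k t = e\<^sup>2 / (t + e\<^sup>2)" for t
  have pos: "0 < t + e\<^sup>2" if "0 \<le> t" for t
    using that e by (simp add: add_nonneg_pos)
  have h: "continuous_on {0..M} h" unfolding h_def
    using pos by (intro continuous_intros GM) force
  have k: "continuous_on {0..M} k" unfolding k_def
    using pos by (intro continuous_intros) force
  have adjX: "inner (X x) y = inner x (adj X y)" for x y
    by (rule is_adjD[OF is_adj_adj[OF X]])
  have "X o\<^sub>L N = N' o\<^sub>L X"
    by (simp add: blinfun_eqI N_def N'_def)
  then have "X o\<^sub>L cfc h N = cfc h N' o\<^sub>L X"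
    by (rule cfc_intertwine[OF N.positive_operator_axioms N'.positive_operator_axioms _ h])
  then have Xh: "X (cfc h N x) = cfc h N' (X x)" for x
    by (metis blinfun_apply_blinfun_compose)
  \<comment> \<open>The identity is split as \<open>h F + k\<close>: the first summand carries the
    main term, the second the error of size \<open>e\<close>.\<close>
  have "id_blinfun = (1::real) *\<^sub>R (id_blinfun :: 'a \<Rightarrow>\<^sub>L 'a)" by simp
  also have "\<dots> = cfc (\<lambda>_. 1) N" by (rule N.cfc_const[symmetric])
  also have "\<dots> = cfc (\<lambda>t. h t * F t + k t) N"
  proof (rule N.cfc_cong)
    fix t :: real assume t: "0 \<le> t" "t \<le> M"
    have "G t * sqrt t * F t = t"
      using FG[OF t(1)] t by (simp add: mult_ac flip: real_sqrt_mult)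
        (metis abs_of_nonneg mult.assoc mult.commute real_sqrt_abs2 real_sqrt_mult)
    then show "1 = h t * F t + k t"
      using pos[OF t(1)] by (simp add: h_def k_def flip: add_divide_distrib)
  qed (intro continuous_intros)
  also have "\<dots> = (cfc h N o\<^sub>L cfc F N) + cfc k N"
    by (simp add: N.cfc_add N.cfc_mult h k FM continuous_on_mult)
  finally have "u = cfc h N (cfc F N u) + cfc k N u"
    by (metis blinfun.add_left blinfun_apply_blinfun_compose id_blinfun.rep_eq)
  then have "inner (X u) v = inner (X (cfc h N (cfc F N u)) + X (cfc k N u)) v"
    by (metis blinfun.add_right)
  also have "\<dots> = inner (cfc F N u) (adj X (cfc h N' v)) + inner (X (cfc k N u)) v"
    by (simp add: inner_add_left Xh is_adjD[OF N'.is_adj_cfc[OF h]] adjX)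
  also have "\<dots> \<le> norm (cfc F N u) * norm (adj X (cfc h N' v)) + norm (X (cfc k N u)) * norm v"
    by (intro add_mono norm_cauchy_schwarz)
  also have "\<dots> \<le> norm (cfc F N u) * norm (cfc G N' v) + (e * norm u) * norm v"
  proof (intro add_mono mult_left_mono mult_right_mono)
    show "norm (adj X (cfc h N' v)) \<le> norm (cfc G N' v)"
    proof (rule power2_le_imp_le)
      have "(norm (adj X (cfc h N' v)))\<^sup>2 = inner (N' (cfc h N' v)) (cfc h N' v)"
        by (simp add: power2_norm_eq_inner N'_def adjX)
      also have "\<dots> = inner (cfc (\<lambda>t. h t * (t * h t)) N' v) v"
        by (rule N'.inner_sandwich_cfc[OF h])
      also have "\<dots> \<le> inner (cfc (\<lambda>t. G t * G t) N' v) v"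
      proof (rule N'.inner_cfc_mono)
        fix t assume t: "0 \<le> t" "t \<le> M"
        have "h t * (t * h t) = (G t * G t) * (t / (t + e\<^sup>2))\<^sup>2"
          using t(1) by (simp add: h_def power2_eq_square mult_ac)
        also have "\<dots> \<le> (G t * G t) * 1"
          using t(1) pos[OF t(1)] by (intro mult_left_mono power_le_one) (auto simp: divide_le_eq_1)
        finally show "h t * (t * h t) \<le> G t * G t" by simp
      qed (intro continuous_intros h GM)+
      also have "\<dots> = (norm (cfc G N' v))\<^sup>2"
        by (rule N'.inner_cfc_square[OF GM])
      finally show "(norm (adj X (cfc h N' v)))\<^sup>2 \<le> (norm (cfc G N' v))\<^sup>2" .
    qed simp
    show "norm (X (cfc k N u)) \<le> e * norm u"
    proof (rule power2_le_imp_le)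
      have "(norm (X (cfc k N u)))\<^sup>2 = inner (N (cfc k N u)) (cfc k N u)"
        by (simp add: power2_norm_eq_inner N_def adjX inner_commute)
      also have "\<dots> = inner (cfc (\<lambda>t. k t * (t * k t)) N u) u"
        by (rule N.inner_sandwich_cfc[OF k])
      also have "\<dots> \<le> inner (cfc (\<lambda>_. e\<^sup>2) N u) u"
      proof (rule N.inner_cfc_mono)
        fix t assume t: "0 \<le> t" "t \<le> M"
        have "k t * (t * k t) = e\<^sup>2 * ((e\<^sup>2 / (t + e\<^sup>2)) * (t / (t + e\<^sup>2)))"
          by (simp add: k_def)
        also have "\<dots> \<le> e\<^sup>2 * (1 * 1)"
          using t(1) pos[OF t(1)] by (intro mult_left_mono mult_mono) (auto simp: divide_le_eq_1)
        finally show "k t * (t * k t) \<le> e\<^sup>2" by simp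
      qed (intro continuous_intros k)+
      also have "\<dots> = (e * norm u)\<^sup>2"
        by (simp add: N.cfc_const blinfun.scaleR_left power_mult_distrib power2_norm_eq_inner)
      finally show "(norm (X (cfc k N u)))\<^sup>2 \<le> (e * norm u)\<^sup>2" .
    qed (use e in simp)
  qed simp_all
  finally show ?thesis by (simp add: N_def N'_def)
qed

text \<open>The rotation commutes with \<open>X\<close> and with \<open>cfc F\<close>, hence changes
  no norm on the right; then the error tends to 0.\<close>

lemma mixed_schwarz:
  assumes X: "X \<in> cblinfun" and F: "continuous_on {0..} F" and G: "continuous_on {0..} G"
    and FG: "\<And>t. 0 \<le> t \<Longrightarrow> F t * G t = sqrt t"
  shows "cmod (cinner (X u) v) \<le> norm (cfc F (adj X o\<^sub>L X) u) * norm (cfc G (X o\<^sub>L adj X) v)"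
proof -
  obtain c where c: "cmod c = 1" "cmod (cinner (X u) v) = inner (c *\<^sub>C X u) v"
    by (rule cmod_cinner_rotate)
  interpret N: positive_operator "adj X o\<^sub>L X" "(norm (adj X))\<^sup>2"
    by (rule positive_operator_gram[OF X order_refl])
  have "cfc F (adj X o\<^sub>L X) \<in> cblinfun"
    by (rule N.cfc_cblinfun) (rule continuous_on_subset[OF F], auto)
  then have norm_eq: "norm (cfc F (adj X o\<^sub>L X) (c *\<^sub>C u)) = norm (cfc F (adj X o\<^sub>L X) u)"
    by (simp add: cblinfunD norm_scaleC c(1))
  show ?thesis
  proof (rule field_le_epsilon)
    fix d :: real assume "0 < d"
    define e where "e = d / (norm u * norm v + 1)"
    have "0 < norm u * norm v + 1" by (simp add: add_nonneg_pos)
    then have e: "0 < e" "e * (norm u * norm v) \<le> d"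
      using \<open>0 < d\<close> by (simp_all add: e_def divide_le_eq algebra_simps)
    have "cmod (cinner (X u) v) = inner (X (c *\<^sub>C u)) v"
      by (simp add: c(2) cblinfunD[OF X])
    also have "\<dots> \<le> norm (cfc F (adj X o\<^sub>L X) (c *\<^sub>C u)) * norm (cfc G (X o\<^sub>L adj X) v)
        + e * norm (c *\<^sub>C u) * norm v"
      by (rule mixed_schwarz_approx[OF X F G FG e(1)])
    also have "\<dots> \<le> norm (cfc F (adj X o\<^sub>L X) u) * norm (cfc G (X o\<^sub>L adj X) v) + d"
      using e(2) by (simp add: norm_eq norm_scaleC c(1) mult.assoc)
    finally show "cmod (cinner (X u) v)
        \<le> norm (cfc F (adj X o\<^sub>L X) u) * norm (cfc G (X o\<^sub>L adj X) v) + d" .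
  qed
qed

text \<open>Mixed Schwarz for \<open>F t = f (sqrt t)\<close> and \<open>G t = g (sqrt t)\<close>,
  whose product is \<open>sqrt t\<close>; the \<open>r\<close>-th power of each norm is then bounded
  by McCarthy's inequality.\<close>

lemma cmod_cinner_powr_le:
  assumes X: "X \<in> cblinfun" and f: "continuous_on {0..} f" "\<And>t. 0 \<le> t \<Longrightarrow> 0 \<le> f t"
    and g: "continuous_on {0..} g" "\<And>t. 0 \<le> t \<Longrightarrow> 0 \<le> g t"
    and fg: "\<And>t. 0 \<le> t \<Longrightarrow> f t * g t = t" and r: "1 \<le> r"
    and u: "norm u \<le> 1" and v: "norm v \<le> 1"
  shows "cmod (cinner (X u) v) powr r
    \<le> sqrt (inner (op_powr (cfc f (abs_op X)) (2 * r) u) u)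
      * sqrt (inner (op_powr (cfc g (abs_op (adj X))) (2 * r) v) v)"
proof -
  interpret N: positive_operator "adj X o\<^sub>L X" "(norm (adj X))\<^sup>2"
    by (rule positive_operator_gram[OF X order_refl])
  interpret N': positive_operator "X o\<^sub>L adj X" "(norm X)\<^sup>2"
    by (rule positive_operator_gram_adj[OF X order_refl])
  have F: "continuous_on {0..} (\<lambda>t. f (sqrt t))"
    by (rule continuous_on_compose2[OF f(1)]) (auto intro!: continuous_intros)
  have G: "continuous_on {0..} (\<lambda>t. g (sqrt t))"
    by (rule continuous_on_compose2[OF g(1)]) (auto intro!: continuous_intros)
  have "cmod (cinner (X u) v) powr r
      \<le> (norm (cfc (\<lambda>t. f (sqrt t)) (adj X o\<^sub>L X) u) * norm (cfc (\<lambda>t. g (sqrt t)) (X o\<^sub>L adj X) v)) powr r"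
    using r by (intro powr_mono2 mixed_schwarz[OF X F G]) (auto simp: fg)
  also have "\<dots> = norm (cfc (\<lambda>t. f (sqrt t)) (adj X o\<^sub>L X) u) powr r
      * norm (cfc (\<lambda>t. g (sqrt t)) (X o\<^sub>L adj X) v) powr r"
    by (simp add: powr_mult)
  also have "\<dots> \<le> sqrt (inner (cfc (\<lambda>t. f (sqrt t) powr (2 * r)) (adj X o\<^sub>L X) u) u)
      * sqrt (inner (cfc (\<lambda>t. g (sqrt t) powr (2 * r)) (X o\<^sub>L adj X) v) v)"
  proof (rule mult_mono)
    show "norm (cfc (\<lambda>t. f (sqrt t)) (adj X o\<^sub>L X) u) powr r
        \<le> sqrt (inner (cfc (\<lambda>t. f (sqrt t) powr (2 * r)) (adj X o\<^sub>L X) u) u)"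
      by (rule N.norm_cfc_powr_le[OF continuous_on_subset[OF F] _ r u]) (auto intro: f)
    show "norm (cfc (\<lambda>t. g (sqrt t)) (X o\<^sub>L adj X) v) powr r
        \<le> sqrt (inner (cfc (\<lambda>t. g (sqrt t) powr (2 * r)) (X o\<^sub>L adj X) v) v)"
      by (rule N'.norm_cfc_powr_le[OF continuous_on_subset[OF G] _ r v]) (auto intro: g)
    show "0 \<le> sqrt (inner (cfc (\<lambda>t. f (sqrt t) powr (2 * r)) (adj X o\<^sub>L X) u) u)"
      by (rule order_trans[OF powr_ge_zero N.norm_cfc_powr_le[OF continuous_on_subset[OF F] _ r u]])
         (auto intro: f)
  qed simp
  finally show ?thesis
    using r by (simp add: op_powr_cfc_abs_op[OF X f] op_powr_cfc_abs_op[OF adj_cblinfun[OF X] g] adj_adj[OF X])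
qed

section \<open>The pointwise bound for the off-diagonal block operator\<close>

lemma inner_op_powr_nonneg:
  assumes X: "X \<in> cblinfun" and f: "continuous_on {0..} f" "\<And>t. 0 \<le> t \<Longrightarrow> 0 \<le> f t" and s: "0 < s"
  shows "0 \<le> inner (op_powr (cfc f (abs_op X)) s u) u"
proof -
  interpret positive_operator "adj X o\<^sub>L X" "(norm (adj X))\<^sup>2"
    by (rule positive_operator_gram[OF X order_refl])
  have "continuous_on {0..(norm (adj X))\<^sup>2} (\<lambda>t. f (sqrt t))"
    by (rule continuous_on_compose2[OF f(1)]) (auto intro!: continuous_intros)
  then have "continuous_on {0..(norm (adj X))\<^sup>2} (\<lambda>t. f (sqrt t) powr s)"
    using s f(2) by (intro continuous_on_powr' continuous_on_const) auto
  then have "0 \<le> inner (cfc (\<lambda>t. f (sqrt t) powr s) (adj X o\<^sub>L X) u) u"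
    by (rule inner_cfc_nonneg) simp
  then show ?thesis
    by (simp only: op_powr_cfc_abs_op[OF X f s])
qed

text \<open>Cauchy-Schwarz in the plane for the roots of \<open>(a, d)\<close> and
  \<open>(b, c)\<close>. This pairing collects terms acting on the same component, so that the two
  sums become the forms of \<open>Q\<close> and \<open>P\<close>.\<close>

lemma sqrt_mult_add_le:
  fixes a b c d :: real
  assumes "0 \<le> a" "0 \<le> b" "0 \<le> c" "0 \<le> d"
  shows "sqrt a * sqrt b + sqrt c * sqrt d \<le> sqrt (a + d) * sqrt (b + c)"
proof -
  have "(sqrt a * sqrt b + sqrt d * sqrt c)\<^sup>2
      \<le> ((sqrt a)\<^sup>2 + (sqrt d)\<^sup>2) * ((sqrt b)\<^sup>2 + (sqrt c)\<^sup>2)"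
    using zero_le_power2[of "sqrt a * sqrt c - sqrt d * sqrt b"]
    by (simp add: power2_eq_square algebra_simps del: real_sqrt_mult_self)
  then have "(sqrt a * sqrt b + sqrt c * sqrt d)\<^sup>2 \<le> (a + d) * (b + c)"
    using assms by (simp add: mult.commute)
  then show ?thesis
    by (simp add: real_le_rsqrt flip: real_sqrt_mult)
qed

lemma block_off_diagonal_bound:
  assumes X: "X \<in> cblinfun" and Y: "Y \<in> cblinfun"
    and f: "continuous_on {0..} f" "\<And>t. 0 \<le> t \<Longrightarrow> 0 \<le> f t"
    and g: "continuous_on {0..} g" "\<And>t. 0 \<le> t \<Longrightarrow> 0 \<le> g t"
    and fg: "\<And>t. 0 \<le> t \<Longrightarrow> f t * g t = t" and r: "1 \<le> r" and w: "norm w \<le> 1"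
    and Q: "Q = op_powr (cfc f (abs_op X)) (2 * r) + op_powr (cfc g (abs_op (adj Y))) (2 * r)"
    and P: "P = op_powr (cfc f (abs_op Y)) (2 * r) + op_powr (cfc g (abs_op (adj X))) (2 * r)"
  shows "cmod (cinner (block_op 0 X Y 0 w) w) powr r
    \<le> 2 powr (r - 2) * (inner (blinfun_apply Q (snd w)) (snd w) + inner (blinfun_apply P (fst w)) (fst w) - eta P Q w)"
proof -
  obtain u v where uv: "w = (u, v)" by (cases w)
  have u: "norm u \<le> 1" and v: "norm v \<le> 1"
    using w norm_fst_le[of u v] norm_snd_le[of v u] unfolding uv by auto
  define a where "a = cmod (cinner (X v) u)"
  define b where "b = cmod (cinner (Y u) v)"
  define S where "S = inner (Q v) v"
  define T where "T = inner (P u) u"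
  define p2 where "p2 = inner (op_powr (cfc f (abs_op X)) (2 * r) v) v"
  define q1 where "q1 = inner (op_powr (cfc g (abs_op (adj X))) (2 * r) u) u"
  define p1 where "p1 = inner (op_powr (cfc f (abs_op Y)) (2 * r) u) u"
  define q2 where "q2 = inner (op_powr (cfc g (abs_op (adj Y))) (2 * r) v) v"
  have "0 < 2 * r" using r by simp
  then have pos: "0 \<le> p1" "0 \<le> p2" "0 \<le> q1" "0 \<le> q2"
    unfolding p1_def p2_def q1_def q2_def
    by (auto intro!: inner_op_powr_nonneg X Y adj_cblinfun f g)
  have S: "S = p2 + q2" and T: "T = q1 + p1"
    by (simp_all add: S_def T_def P Q p1_def p2_def q1_def q2_def blinfun.add_left inner_add_left)
  have "cmod (cinner (block_op 0 X Y 0 w) w) \<le> a + b"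
    unfolding a_def b_def uv block_op_apply by (simp add: cinner_prod_def norm_triangle_ineq)
  then have "cmod (cinner (block_op 0 X Y 0 w) w) powr r \<le> (a + b) powr r"
    using r by (intro powr_mono2) auto
  also have "\<dots> \<le> 2 powr (r - 1) * (a powr r + b powr r)"
    using r by (intro powr_add_le) (simp_all add: a_def b_def)
  also have "\<dots> \<le> 2 powr (r - 1) * (sqrt p2 * sqrt q1 + sqrt p1 * sqrt q2)"
    unfolding a_def b_def p1_def p2_def q1_def q2_def
    by (intro mult_left_mono add_mono cmod_cinner_powr_le X Y f g fg r u v) auto
  also have "\<dots> \<le> 2 powr (r - 1) * (sqrt S * sqrt T)"
    unfolding S T by (intro mult_left_mono sqrt_mult_add_le pos) simp
  \<comment> \<open>One factor 2 is released for the square identity that produces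
    \<open>eta\<close>.\<close>
  also have "\<dots> = 2 powr (r - 2) * (2 * sqrt S * sqrt T)"
    by (simp add: powr_diff)
  also have "2 * sqrt S * sqrt T = S + T - (sqrt S - sqrt T)\<^sup>2"
    using pos by (simp add: power2_diff S T)
  also have "(sqrt S - sqrt T)\<^sup>2 = eta P Q w"
    by (simp add: eta_def uv S_def T_def inner_eq_Re_cinner)
  finally show ?thesis by (simp add: uv S_def T_def)
qed

section \<open>Berezin numbers\<close>

lemma norm_normalized_le: "norm (normalized k l) \<le> 1"
  by (cases "k l = 0") (simp_all add: normalized_def)

lemma cmod_cinner_le: "cmod (cinner x y) \<le> norm x * norm y"
  for x y :: "'a::complex_hilbert"
proof -
  obtain c where "cmod c = 1" "cmod (cinner x y) = inner (c *\<^sub>C x) y"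
    by (rule cmod_cinner_rotate)
  then show ?thesis
    using norm_cauchy_schwarz[of "c *\<^sub>C x" y] by (simp add: norm_scaleC)
qed

text \<open>The supremum is a genuine upper bound because \<open>norm A\<close> bounds all
  symbols.\<close>

lemma cmod_berezin_symbol_le_ber:
  assumes "l \<in> \<Omega>"
  shows "cmod (berezin_symbol k A l) \<le> ber \<Omega> k A"
  unfolding ber_def
proof (rule cSUP_upper[OF assms bdd_aboveI2])
  fix l
  let ?x = "normalized k l"
  have "cmod (berezin_symbol k A l) \<le> norm (A ?x) * norm ?x"
    unfolding berezin_symbol_def by (rule cmod_cinner_le)
  also have "\<dots> \<le> (norm A * 1) * 1"
    by (intro mult_mono order_trans[OF norm_blinfun] norm_normalized_le mult_left_mono) simp_all
  finally show "cmod (berezin_symbol k A l) \<le> norm A" by simp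
qed

text \<open>A component of the normalized pair is a unit kernel shrunk by a factor \<open>s\<close>
  at most 1. Passing from the real part to the modulus first allows \<open>s * s\<close> to be
  replaced by 1.\<close>

lemma inner_scaled_kernel_le_ber:
  assumes "l \<in> \<Omega>" "norm (k l) \<le> n"
  shows "inner (blinfun_apply A (k l /\<^sub>R n)) (k l /\<^sub>R n) \<le> ber \<Omega> k A"
proof -
  define s where "s = norm (k l) / n"
  have "0 \<le> n" using assms(2) norm_ge_zero order_trans by blast
  then have s: "0 \<le> s" "s \<le> 1"
    using assms(2) by (auto simp: s_def divide_le_eq_1)
  have eq: "k l /\<^sub>R n = s *\<^sub>R normalized k l"
    by (cases "k l = 0") (simp_all add: s_def normalized_def divide_inverse)
  have "inner (A (k l /\<^sub>R n)) (k l /\<^sub>R n) = (s * s) * Re (berezin_symbol k A l)"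
    unfolding eq by (simp add: blinfun.scaleR_right berezin_symbol_def inner_eq_Re_cinner[symmetric])
  also have "\<dots> \<le> (s * s) * cmod (berezin_symbol k A l)"
    by (intro mult_left_mono complex_Re_le_cmod) simp
  also have "\<dots> \<le> 1 * cmod (berezin_symbol k A l)"
    using s by (intro mult_right_mono mult_le_one) auto
  also have "\<dots> \<le> ber \<Omega> k A"
    using cmod_berezin_symbol_le_ber[OF assms(1)] by simp
  finally show ?thesis .
qed

theorem theorem2p9:
  fixes \<Omega>1 :: "'v set" and \<Omega>2 :: "'w set"
    and ev1 :: "'a::complex_hilbert \<Rightarrow> 'v \<Rightarrow> complex"
    and ev2 :: "'b::complex_hilbert \<Rightarrow> 'w \<Rightarrow> complex"
    and X :: "'b \<Rightarrow>\<^sub>L 'a" and Y :: "'a \<Rightarrow>\<^sub>L 'b"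
    and f g :: "real \<Rightarrow> real" and r :: real
  assumes "functional_hilbert_space \<Omega>1 ev1"
    and "functional_hilbert_space \<Omega>2 ev2"
    and "\<And>l. l \<in> \<Omega>1 \<Longrightarrow> rep_kernel ev1 l \<noteq> 0"
    and "\<And>l. l \<in> \<Omega>2 \<Longrightarrow> rep_kernel ev2 l \<noteq> 0"
    and "X \<in> cblinfun" and "Y \<in> cblinfun"
    and "continuous_on {0..} f" and "continuous_on {0..} g"
    and "\<And>t. t \<ge> 0 \<Longrightarrow> f t \<ge> 0" and "\<And>t. t \<ge> 0 \<Longrightarrow> g t \<ge> 0"
    and "\<And>t. t \<ge> 0 \<Longrightarrow> f t * g t = t"
    and "r \<ge> 1"
  shows "let k1 = rep_kernel ev1; k2 = rep_kernel ev2; k = sum_kernel k1 k2;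
             T = block_op 0 X Y 0;
             Q = op_powr (cfc f (abs_op X)) (2 * r) + op_powr (cfc g (abs_op (adj Y))) (2 * r);
             P = op_powr (cfc f (abs_op Y)) (2 * r) + op_powr (cfc g (abs_op (adj X))) (2 * r)
         in ber (\<Omega>1 \<times> \<Omega>2) k T powr r
              \<le> 2 powr (r - 2) * (ber \<Omega>2 k2 Q + ber \<Omega>1 k1 P)
                - 2 powr (r - 2) * (INF l\<in>\<Omega>1 \<times> \<Omega>2. eta P Q (normalized k l))"
proof -
  define k1 where "k1 = rep_kernel ev1"
  define k2 where "k2 = rep_kernel ev2"
  define k where "k = sum_kernel k1 k2"
  define T where "T = block_op 0 X Y 0"
  define Q where "Q = op_powr (cfc f (abs_op X)) (2 * r) + op_powr (cfc g (abs_op (adj Y))) (2 * r)"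
  define P where "P = op_powr (cfc f (abs_op Y)) (2 * r) + op_powr (cfc g (abs_op (adj X))) (2 * r)"
  define R where "R = 2 powr (r - 2) * (ber \<Omega>2 k2 Q + ber \<Omega>1 k1 P
      - (INF l\<in>\<Omega>1 \<times> \<Omega>2. eta P Q (normalized k l)))"
  have ne: "\<Omega>1 \<times> \<Omega>2 \<noteq> {}"
    using functional_hilbert_space.nonempty[OF assms(1)] functional_hilbert_space.nonempty[OF assms(2)] by simp
  have bound: "cmod (berezin_symbol k T l) powr r \<le> R" if l: "l \<in> \<Omega>1 \<times> \<Omega>2" for l
  proof -
    let ?w = "normalized k l" and ?n = "norm (k l)"
    have k: "k l = (k1 (fst l), k2 (snd l))"
      by (simp add: k_def sum_kernel_def)
    have "cmod (berezin_symbol k T l) powr r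
        \<le> 2 powr (r - 2) * (inner (Q (snd ?w)) (snd ?w) + inner (P (fst ?w)) (fst ?w) - eta P Q ?w)"
      unfolding berezin_symbol_def T_def
      by (rule block_off_diagonal_bound[OF assms(5,6) assms(7) assms(9) assms(8) assms(10) assms(11,12)
            norm_normalized_le Q_def P_def])
    also have "\<dots> \<le> R"
      unfolding R_def
    proof (intro mult_left_mono diff_mono add_mono)
      have w: "fst ?w = k1 (fst l) /\<^sub>R ?n" "snd ?w = k2 (snd l) /\<^sub>R ?n"
        by (simp_all add: normalized_def k)
      show "inner (Q (snd ?w)) (snd ?w) \<le> ber \<Omega>2 k2 Q"
        unfolding w
        by (rule inner_scaled_kernel_le_ber) (use l norm_snd_le[of "k2 (snd l)" "k1 (fst l)"] in \<open>auto simp: k\<close>)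
      show "inner (P (fst ?w)) (fst ?w) \<le> ber \<Omega>1 k1 P"
        unfolding w
        by (rule inner_scaled_kernel_le_ber) (use l norm_fst_le[of "k1 (fst l)" "k2 (snd l)"] in \<open>auto simp: k\<close>)
      \<comment> \<open>A square is bounded below by 0, so the infimum is a lower bound.\<close>
      show "(INF l\<in>\<Omega>1 \<times> \<Omega>2. eta P Q (normalized k l)) \<le> eta P Q ?w"
        by (rule cINF_lower[OF bdd_belowI2[of _ 0] l]) (simp add: eta_def)
    qed simp
    finally show ?thesis .
  qed
  obtain l where l: "l \<in> \<Omega>1 \<times> \<Omega>2" using ne by blast
  \<comment> \<open>Nonnegativity lets \<open>(R powr (1 / r)) powr r\<close> collapse to
    \<open>R\<close>: the pointwise bound is passed to the supremum through \<open>r\<close>-th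
    roots and then raised back.\<close>
  have "0 \<le> R" by (rule order_trans[OF powr_ge_zero bound[OF l]])
  have "0 \<le> ber (\<Omega>1 \<times> \<Omega>2) k T"
    by (rule order_trans[OF norm_ge_zero cmod_berezin_symbol_le_ber[OF l]])
  moreover have "ber (\<Omega>1 \<times> \<Omega>2) k T \<le> R powr (1 / r)"
    unfolding ber_def
  proof (rule cSUP_least[OF ne])
    fix l assume "l \<in> \<Omega>1 \<times> \<Omega>2"
    then have "(cmod (berezin_symbol k T l) powr r) powr (1 / r) \<le> R powr (1 / r)"
      using assms(12) by (intro powr_mono2 bound) auto
    then show "cmod (berezin_symbol k T l) \<le> R powr (1 / r)"
      using assms(12) by (simp add: powr_powr)
  qed
  ultimately have "ber (\<Omega>1 \<times> \<Omega>2) k T powr r \<le> (R powr (1 / r)) powr r"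
    using assms(12) by (intro powr_mono2) auto
  also have "\<dots> = R"
    using assms(12) \<open>0 \<le> R\<close> by (simp add: powr_powr)
  finally show ?thesis
    unfolding Let_def R_def k_def k1_def k2_def T_def Q_def P_def right_diff_distrib .
qed

end
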